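(* Suppose $f$ is twice continuously differentiable with Lipschitz continuous gradient $\nabla f$. Let $\{x_k\}$ be generated by Algorithm RPN-CG (defined in the context) for $\min_{x\in\mathcal M}F(x)=f(x)+\mu\|x\|_1$. Suppose $t_{\min}$ is sufficiently small such that, for $t=t_{\min}$, $(4+1/t)\|d(x)\|_F\ge\|v(x)\|_F$ holds for every $x\in\mathcal M$. Then $$\liminf_{k\to\infty}\|v(x_k)\|_F=0.$$
   Context: Setting. $\mathbb R^n$ carries the Euclidean inner product $\langle\cdot,\cdot\rangle$ and norm $\|\cdot\|_F$. $\mathcal M\subset\mathbb R^n$ is a compact embedded submanifold with the induced Riemannian metric; $c=n-\dim\mathcal M$; $T_x\mathcal M$, $N_x\mathcal M$ are tangent and normal spaces; $P_L$ is the orthogonal projection onto a subspace $L$. $F=f+h$ with $h(x)=\mu\|x\|_1$, $\mu>0$, $f:\mathbb R^n\to\mathbb R$ with Euclidean gradient $\nabla f$ and Hessian $\nabla^2f$. $R$ is a retraction: a smooth map $T\mathcal M\to\mathcal M$ with $R_x(0_x)=x$, $\mathrm D R_x(0_x)=\mathrm{id}$. $B_x\in\mathbb R^{n\times c}$ has as columns an orthonormal basis of $N_x\mathcal M$, so $T_x\mathcal M=\{v:B_x^Tv=0\}$. The Weingarten map is $\mathcal W_x(w,u)=(\mathrm D(y\mapsto P_{T_y\mathcal M})(x)[w])u$ for $w\in T_x\mathcal M$, $u\in N_x\mathcal M$. Proximal gradient direction. For $t>0$, $v(x)=\arg\min_{v\in T_x\mathcal M} f(x)+\langle\nabla f(x),v\rangle+\frac1{2t}\|v\|_F^2+h(x+v)$,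 and $\lambda(x)\in\mathbb R^{c}$ is a Lagrange multiplier, i.e. $v(x)=\mathrm{prox}_{th}(x-t[\nabla f(x)+B_x\lambda(x)])-x$ with $\mathrm{prox}_{th}(z)=\max(|z|-t\mu,0)\odot\mathrm{sign}(z)$ and $B_x^Tv(x)=0$. Partition. Let $j$ be the number of nonzero entries of $x+v(x)$; order coordinates so these are the first $j$. For a vector or matrix $A$ with $n$ rows, $\bar A$ is its first $j$ rows and $\hat A$ its last $n-j$ rows. $\mathcal L_x(\cdot)=\mathcal W_x(\cdot,B_x\lambda(x))$, regarded as a symmetric operator on $\mathbb R^n$ by precomposition with $P_{T_x\mathcal M}$; $\mathfrak B_x=\nabla^2f(x)-\mathcal L_x=\begin{pmatrix}\mathcal B_x&\mathfrak B_x^{(12)}\\ \mathfrak B_x^{(21)}&\mathfrak B_x^{(22)}\end{pmatrix}$ with $\mathcal B_x\in\mathbb R^{j\times j}$. All these depend on $t$. Put $\ell_{x,t}=\frac1t(-I_j+t\mathcal B_x)\bar v(x)+\mathfrak B_x^{(12)}\hat v(x)$. Truncated CG (tCG). Parameters $\vartheta,\gamma,\tau,\theta>0$, $\kappa\in(0,1)$. $P_x=I_j-\bar B_x\bar B_x^\dagger$; $G_x(u)=f(x)+\langle\nabla f(x),u\rangle+\frac12\langle u,\mathfrak B_xu\rangle+\frac\tau2\|\hat u\|_F^2+h(x+u)$. Output $(w(x),\mathrm{status})$: (1) If $G_x(v(x))>G_x(0)$, return $w(x)=0$, status early1. (2) If $\langle v(x),\mathfrak B_xv(x)\rangle+\tau\|\hat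 v(x)\|_F^2<\gamma\|v(x)\|_F^2$, return $w(x)=0$, status early2. (3) $w_0=0$, $r_0=P_x\ell_{x,t}$, $o_0=-r_0$, $\delta_0=\langle r_0,r_0\rangle$. For $i=0,1,\dots$: $q_i=P_x\mathcal B_xo_i$; if $\langle o_i,q_i\rangle\le\vartheta\delta_i$, return $w(x)=w_i$, status neg. Set $\alpha_i=\langle r_i,r_i\rangle/\langle o_i,q_i\rangle$, $w_{i+1}=w_i+\alpha_io_i$, $r_{i+1}=r_i+\alpha_iq_i$, $d_{i+1}=\begin{pmatrix}\bar v(x)+w_{i+1}\\ \hat v(x)\end{pmatrix}$. If $\langle d_{i+1},\mathfrak B_xd_{i+1}\rangle+\tau\|\hat v(x)\|_F^2<\gamma\|d_{i+1}\|_F^2$ or $G_x(d_{i+1})>G_x(0)$, return $w(x)=w_i$, status early3. Set $\beta_{i+1}=\langle r_{i+1},r_{i+1}\rangle/\langle r_i,r_i\rangle$, $o_{i+1}=-r_{i+1}+\beta_{i+1}o_i$, $\delta_{i+1}=\langle r_{i+1},r_{i+1}\rangle+\beta_{i+1}^2\delta_i$. If $\|r_{i+1}\|_F\le\|r_0\|_F\min(\|r_0\|_F^\theta,\kappa)$, return $w(x)=w_{i+1}$ with status lin if $\|r_0\|_F^\theta>\kappa$ and sup otherwise. The search direction is $d(x)=\begin{pmatrix}\bar v(x)+w(x)\\ \hat v(x)\end{pmatrix}$. Algorithm RPN-CG. Parameters: $x_0\in\mathcal M$, $\alpha_{\mathrm{init}}>0$, $\rho_1,\rho_2\in(0,1)$,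 $t_{\max}\ge t_{\min}>0$, $t_0\in[t_{\min},t_{\max}]$, $\varpi_1>1$, $\varpi_2\in(0,1)$, and the tCG parameters. Set flag $=0$, $k=0$ and loop: (a) compute $v(x_k)$ with $t=t_k$, run tCG at $x_k$ with $t=t_k$, and form $d(x_k)$. (b) If $(4+1/t_k)\|d(x_k)\|_F<\|v(x_k)\|_F$ or status is early1, set $t_{k+1}=\max(\varpi_2t_k,t_{\min})$; else if status is not sup, set $t_{k+1}=\min(\varpi_1t_k,t_{\max})$; else $t_{k+1}=t_k$. (c) If status is not sup and flag $\ne1$: set flag $=0$, $\alpha_k=\alpha_{\mathrm{init}}$; while $F(R_{x_k}(\alpha_kd(x_k)))>F(x_k)-\alpha_k\rho_1\|d(x_k)\|_F^2$ replace $\alpha_k$ by $\rho_2\alpha_k$; set $x_{k+1}=R_{x_k}(\alpha_kd(x_k))$, $k\leftarrow k+1$. (d) Otherwise flag $\leftarrow$ flag $+1$. If flag $=1$: $x_{k+1}=R_{x_k}(d(x_k))$, $k\leftarrow k+1$. Else: $x_{k+1}=R_{x_k}(d(x_k))$, flag $=0$; if $F(x_{k+1})>F(x_{k-1})-\rho_1\|v(x_{k-1})\|_F^2$, backtrack at $x_{k-1}$: starting from $\alpha_{k-1}=\alpha_{\mathrm{init}}$, while $F(R_{x_{k-1}}(\alpha_{k-1}d(x_{k-1})))>F(x_{k-1})-\alpha_{k-1}\rho_1\|d(x_{k-1})\|_F^2$ replace $\alpha_{k-1}$ by $\rho_2\alpha_{k-1}$, then overwrite $x_k=R_{x_{k-1}}(\alpha_{k-1}d(x_{k-1}))$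 ($k$ unchanged); otherwise accept and $k\leftarrow k+1$.
   Formalization: The line-search parameter is additionally required to satisfy ρ_1 < γ/2 and ρ_1 < 1/t_max; for arbitrary ρ_1 in (0,1) the backtracking steps can shrink to zero and the claim is false. *)

theory Defs
  imports "HOL-Analysis.Analysis"
begin

section \<open>Smoothness, submanifolds, retractions\<close>

text \<open>
  \<open>C_on k S g\<close> is meant for open \<open>S\<close> in a finite-dimensional space, where being \<open>C\<^sup>k\<close> amounts
  to all directional derivatives of the differentiable map \<open>g\<close> being \<open>C\<^bsup>k-1\<^esup>\<close>.
\<close>

primrec C_on :: "nat \<Rightarrow> 'a::real_normed_vector set \<Rightarrow> ('a \<Rightarrow> 'b::real_normed_vector) \<Rightarrow> bool" where
  "C_on 0 S g \<longleftrightarrow> continuous_on S g"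
| "C_on (Suc k) S g \<longleftrightarrow>
     (\<forall>x\<in>S. g differentiable (at x)) \<and> (\<forall>v. C_on k S (\<lambda>x. frechet_derivative g (at x) v))"

definition smooth_on :: "'a::real_normed_vector set \<Rightarrow> ('a \<Rightarrow> 'b::real_normed_vector) \<Rightarrow> bool" where
  "smooth_on S g \<longleftrightarrow> (\<forall>k. C_on k S g)"

text \<open>Smoothness on a set that need not be open: local smooth extendability to the ambient space.\<close>

definition smooth_map_on :: "'a::real_normed_vector set \<Rightarrow> ('a \<Rightarrow> 'b::real_normed_vector) \<Rightarrow> bool" where
  "smooth_map_on S g \<longleftrightarrow>
     (\<forall>p\<in>S. \<exists>U g'. open U \<and> p \<in> U \<and> smooth_on U g' \<and> (\<forall>q\<in>S \<inter> U. g' q = g q))"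

text \<open>Embedded submanifold of dimension \<open>m\<close>, by smooth slice charts of the ambient space.\<close>

definition embedded_submanifold :: "'a::euclidean_space set \<Rightarrow> nat \<Rightarrow> bool" where
  "embedded_submanifold M m \<longleftrightarrow>
     (\<forall>p\<in>M. \<exists>U V (\<Phi>::'a \<Rightarrow> 'a) \<Psi> L. open U \<and> p \<in> U \<and> open V \<and>
        homeomorphism U V \<Phi> \<Psi> \<and> smooth_on U \<Phi> \<and> smooth_on V \<Psi> \<and>
        subspace L \<and> dim L = m \<and> \<Phi> ` (U \<inter> M) = V \<inter> L)"

definition tangent_space :: "'a::euclidean_space set \<Rightarrow> 'a \<Rightarrow> 'a set" where
  "tangent_space M x =
     {v. \<exists>\<epsilon>>0. \<exists>c. smooth_on {-\<epsilon><..<\<epsilon>::real} c \<and> c ` {-\<epsilon><..<\<epsilon>} \<subseteq> M \<and> c 0 = x \<and>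
                 (c has_vector_derivative v) (at 0)}"

definition normal_space :: "'a::euclidean_space set \<Rightarrow> 'a \<Rightarrow> 'a set" where
  "normal_space M x = orthogonal_comp (tangent_space M x)"

definition tangent_bundle :: "'a::euclidean_space set \<Rightarrow> ('a \<times> 'a) set" where
  "tangent_bundle M = {(x, v). x \<in> M \<and> v \<in> tangent_space M x}"

definition riem_retraction :: "'a::euclidean_space set \<Rightarrow> ('a \<Rightarrow> 'a \<Rightarrow> 'a) \<Rightarrow> bool" where
  "riem_retraction M R \<longleftrightarrow>
     (\<forall>(x, v)\<in>tangent_bundle M. R x v \<in> M) \<and>
     smooth_map_on (tangent_bundle M) (\<lambda>(x, v). R x v) \<and>
     (\<forall>x\<in>M. R x 0 = x \<and> (R x has_derivative (\<lambda>v. v)) (at 0 within tangent_space M x))"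

definition orth_proj :: "'a::euclidean_space set \<Rightarrow> 'a \<Rightarrow> 'a" where
  "orth_proj L u = (THE y. y \<in> L \<and> u - y \<in> orthogonal_comp L)"

text \<open>
  The differential of \<open>y \<mapsto> P\<^bsub>T\<^sub>yM\<^esub>\<close>, a matrix-valued map on \<open>M\<close>, is taken within \<open>M\<close>; it is
  determined only in tangent directions \<open>w\<close>.
\<close>

definition weingarten :: "(real^'n) set \<Rightarrow> real^'n \<Rightarrow> real^'n \<Rightarrow> real^'n \<Rightarrow> real^'n" where
  "weingarten M x w u =
     frechet_derivative (\<lambda>y. matrix (orth_proj (tangent_space M y))) (at x within M) w *v u"

definition orthonormal_normal_basis :: "(real^'n) set \<Rightarrow> real^'n \<Rightarrow> real^'c^'n \<Rightarrow> bool" where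
  "orthonormal_normal_basis M x B \<longleftrightarrow>
     (\<forall>i j. column i B \<bullet> column j B = (if i = j then 1 else 0)) \<and>
     span (columns B) = normal_space M x"


section \<open>Derivatives of \<open>f\<close>, the \<open>\<ell>\<^sub>1\<close> term, pseudoinverse\<close>

definition gradient :: "('a::euclidean_space \<Rightarrow> real) \<Rightarrow> 'a \<Rightarrow> 'a" where
  "gradient f x = (THE g. GDERIV f x :> g)"

definition hessian :: "(real^'n \<Rightarrow> real) \<Rightarrow> real^'n \<Rightarrow> real^'n^'n" where
  "hessian f x = matrix (frechet_derivative (gradient f) (at x))"

definition l1_norm :: "real^'n \<Rightarrow> real" where
  "l1_norm x = (\<Sum>i\<in>UNIV. \<bar>x $ i\<bar>)"

definition prox_l1 :: "real \<Rightarrow> real \<Rightarrow> real^'n \<Rightarrow> real^'n" where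
  "prox_l1 \<mu> t z = (\<chi> i. max (\<bar>z $ i\<bar> - t * \<mu>) 0 * sgn (z $ i))"

definition pinv :: "real^'c^'n \<Rightarrow> real^'n^'c" where
  "pinv A = (THE X. A ** X ** A = A \<and> X ** A ** X = X \<and>
                    transpose (A ** X) = A ** X \<and> transpose (X ** A) = X ** A)"

text \<open>
  Block vectors and matrices have sizes depending on the point, so the blocks are represented
  inside \<open>\<real>\<^sup>n\<close> by padding with zeros: for an index set \<open>J\<close>, \<open>restrict_rows J u\<close> keeps the entries
  in \<open>J\<close> and \<open>restrict_rows (- J) u\<close> the remaining ones, and no reordering of the coordinates is
  needed.  Stacking two blocks is addition, and padding commutes with inner products, norms,
  products and the pseudoinverse.  The same function keeps or zeroes the rows of a matrix.
\<close>

definition restrict_rows :: "'n set \<Rightarrow> 'a::zero^'n \<Rightarrow> 'a^'n" where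
  "restrict_rows J A = (\<chi> i. if i \<in> J then A $ i else 0)"


section \<open>The algorithm\<close>

datatype status = Early1 | Early2 | Early3 | NegCurv | LinRes | SupRes

text \<open>
  \<open>xs k\<close>, \<open>ts k\<close>, \<open>ds k\<close> are the current contents of \<open>x\<^sub>k\<close>, \<open>t\<^sub>k\<close>, \<open>d(x\<^sub>k)\<close>; entries not yet
  computed are arbitrary.
\<close>

datatype 'v rpn_state =
  State (iter: nat) (flag: nat) (xs: "nat \<Rightarrow> 'v") (ts: "nat \<Rightarrow> real") (ds: "nat \<Rightarrow> 'v")

locale rpn_cg =
  fixes M :: "(real^'n) set"
    and R :: "real^'n \<Rightarrow> real^'n \<Rightarrow> real^'n"
    and f :: "real^'n \<Rightarrow> real"
    and \<mu> :: real
    and B :: "real^'n \<Rightarrow> real^'c^'n"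
    and lam :: "real \<Rightarrow> real^'n \<Rightarrow> real^'c"
    and vartheta \<gamma> \<tau> \<theta> \<kappa> :: real
    and \<alpha>init \<rho>1 \<rho>2 tmin tmax \<omega>1 \<omega>2 :: real
begin

definition h :: "real^'n \<Rightarrow> real" where
  "h x = \<mu> * l1_norm x"

definition F :: "real^'n \<Rightarrow> real" where
  "F x = f x + h x"

definition pg_dir :: "real \<Rightarrow> real^'n \<Rightarrow> real^'n" where
  "pg_dir t x = arg_min_on
     (\<lambda>v. f x + gradient f x \<bullet> v + 1 / (2 * t) * (norm v)\<^sup>2 + h (x + v)) (tangent_space M x)"

definition lagrange_multiplier :: "real \<Rightarrow> real^'n \<Rightarrow> real^'c \<Rightarrow> bool" where
  "lagrange_multiplier t x l \<longleftrightarrow>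
     pg_dir t x = prox_l1 \<mu> t (x - t *\<^sub>R (gradient f x + B x *v l)) - x \<and>
     transpose (B x) *v pg_dir t x = 0"

definition supp :: "real \<Rightarrow> real^'n \<Rightarrow> 'n set" where
  "supp t x = {i. (x + pg_dir t x) $ i \<noteq> 0}"

abbreviation bar :: "real \<Rightarrow> real^'n \<Rightarrow> 'a::zero^'n \<Rightarrow> 'a^'n" where
  "bar t x \<equiv> restrict_rows (supp t x)"

abbreviation hat :: "real \<Rightarrow> real^'n \<Rightarrow> 'a::zero^'n \<Rightarrow> 'a^'n" where
  "hat t x \<equiv> restrict_rows (- supp t x)"

definition L_op :: "real \<Rightarrow> real^'n \<Rightarrow> real^'n \<Rightarrow> real^'n" where
  "L_op t x u = weingarten M x (orth_proj (tangent_space M x) u) (B x *v lam t x)"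

definition B_op :: "real \<Rightarrow> real^'n \<Rightarrow> real^'n \<Rightarrow> real^'n" where
  "B_op t x u = hessian f x *v u - L_op t x u"

definition B11_op :: "real \<Rightarrow> real^'n \<Rightarrow> real^'n \<Rightarrow> real^'n" where
  "B11_op t x u = bar t x (B_op t x (bar t x u))"

definition B12_op :: "real \<Rightarrow> real^'n \<Rightarrow> real^'n \<Rightarrow> real^'n" where
  "B12_op t x u = bar t x (B_op t x (hat t x u))"

definition ell :: "real \<Rightarrow> real^'n \<Rightarrow> real^'n" where
  "ell t x =
     (1 / t) *\<^sub>R (- bar t x (pg_dir t x) + t *\<^sub>R B11_op t x (bar t x (pg_dir t x)))
     + B12_op t x (hat t x (pg_dir t x))"

definition P_op :: "real \<Rightarrow> real^'n \<Rightarrow> real^'n \<Rightarrow> real^'n" where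
  "P_op t x u = bar t x u - (bar t x (B x) ** pinv (bar t x (B x))) *v u"

definition G :: "real \<Rightarrow> real^'n \<Rightarrow> real^'n \<Rightarrow> real" where
  "G t x u = f x + gradient f x \<bullet> u + 1 / 2 * (u \<bullet> B_op t x u)
     + \<tau> / 2 * (norm (hat t x u))\<^sup>2 + h (x + u)"

definition curv_too_small :: "real \<Rightarrow> real^'n \<Rightarrow> real^'n \<Rightarrow> bool" where
  "curv_too_small t x d \<longleftrightarrow>
     d \<bullet> B_op t x d + \<tau> * (norm (hat t x (pg_dir t x)))\<^sup>2 < \<gamma> * (norm d)\<^sup>2"

definition stack :: "real \<Rightarrow> real^'n \<Rightarrow> real^'n \<Rightarrow> real^'n" where
  "stack t x w = (bar t x (pg_dir t x) + w) + hat t x (pg_dir t x)"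

text \<open>
  \<open>tcg_loop t x r0 w r p \<delta> w' st\<close>: entering the loop body with \<open>w\<^sub>i = w\<close>, \<open>r\<^sub>i = r\<close>, \<open>o\<^sub>i = p\<close>,
  \<open>\<delta>\<^sub>i = \<delta>\<close>, the iteration eventually returns \<open>w'\<close> with status \<open>st\<close>.
\<close>

inductive tcg_loop ::
  "real \<Rightarrow> real^'n \<Rightarrow> real^'n \<Rightarrow> real^'n \<Rightarrow> real^'n \<Rightarrow> real^'n \<Rightarrow> real \<Rightarrow> real^'n \<Rightarrow> status \<Rightarrow> bool"
  for t x r0 where
  neg:
    "\<lbrakk> q = P_op t x (B11_op t x p); p \<bullet> q \<le> vartheta * \<delta> \<rbrakk>
     \<Longrightarrow> tcg_loop t x r0 w r p \<delta> w NegCurv"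
| early3:
    "\<lbrakk> q = P_op t x (B11_op t x p); \<not> p \<bullet> q \<le> vartheta * \<delta>;
       \<alpha> = (r \<bullet> r) / (p \<bullet> q); w1 = w + \<alpha> *\<^sub>R p; d1 = stack t x w1;
       curv_too_small t x d1 \<or> G t x d1 > G t x 0 \<rbrakk>
     \<Longrightarrow> tcg_loop t x r0 w r p \<delta> w Early3"
| converged:
    "\<lbrakk> q = P_op t x (B11_op t x p); \<not> p \<bullet> q \<le> vartheta * \<delta>;
       \<alpha> = (r \<bullet> r) / (p \<bullet> q); w1 = w + \<alpha> *\<^sub>R p; r1 = r + \<alpha> *\<^sub>R q; d1 = stack t x w1;
       \<not> (curv_too_small t x d1 \<or> G t x d1 > G t x 0);
       norm r1 \<le> norm r0 * min (norm r0 powr \<theta>) \<kappa> \<rbrakk>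
     \<Longrightarrow> tcg_loop t x r0 w r p \<delta> w1 (if norm r0 powr \<theta> > \<kappa> then LinRes else SupRes)"
| continue:
    "\<lbrakk> q = P_op t x (B11_op t x p); \<not> p \<bullet> q \<le> vartheta * \<delta>;
       \<alpha> = (r \<bullet> r) / (p \<bullet> q); w1 = w + \<alpha> *\<^sub>R p; r1 = r + \<alpha> *\<^sub>R q; d1 = stack t x w1;
       \<not> (curv_too_small t x d1 \<or> G t x d1 > G t x 0);
       \<beta> = (r1 \<bullet> r1) / (r \<bullet> r); p1 = - r1 + \<beta> *\<^sub>R p; \<delta>1 = r1 \<bullet> r1 + \<beta>\<^sup>2 * \<delta>;
       \<not> norm r1 \<le> norm r0 * min (norm r0 powr \<theta>) \<kappa>;
       tcg_loop t x r0 w1 r1 p1 \<delta>1 w' st \<rbrakk>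
     \<Longrightarrow> tcg_loop t x r0 w r p \<delta> w' st"

definition tcg :: "real \<Rightarrow> real^'n \<Rightarrow> real^'n \<Rightarrow> status \<Rightarrow> bool" where
  "tcg t x w st \<longleftrightarrow>
     (if G t x (pg_dir t x) > G t x 0 then w = 0 \<and> st = Early1
      else if curv_too_small t x (pg_dir t x) then w = 0 \<and> st = Early2
      else (let r0 = P_op t x (ell t x) in tcg_loop t x r0 0 r0 (- r0) (r0 \<bullet> r0) w st))"

definition search_dir :: "real \<Rightarrow> real^'n \<Rightarrow> real^'n \<Rightarrow> status \<Rightarrow> bool" where
  "search_dir t x d st \<longleftrightarrow> (\<exists>w. tcg t x w st \<and> d = stack t x w)"

definition next_t :: "real \<Rightarrow> real^'n \<Rightarrow> real^'n \<Rightarrow> status \<Rightarrow> real" where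
  "next_t t x d st =
     (if (4 + 1 / t) * norm d < norm (pg_dir t x) \<or> st = Early1 then max (\<omega>2 * t) tmin
      else if st \<noteq> SupRes then min (\<omega>1 * t) tmax
      else t)"

definition insufficient_decrease :: "real^'n \<Rightarrow> real^'n \<Rightarrow> real \<Rightarrow> bool" where
  "insufficient_decrease x d \<alpha> \<longleftrightarrow> F (R x (\<alpha> *\<^sub>R d)) > F x - \<alpha> * \<rho>1 * (norm d)\<^sup>2"

text \<open>
  Directions \<open>d\<close> that pass the truncated-CG tests have slope
  \<open>gradient f x \<bullet> d + h (x + d) - h x\<close> at most \<open>- \<gamma> / 2 * (norm d)\<^sup>2\<close>, and \<open>d = pg_dir t x\<close> has slope
  at most \<open>- 1 / t * (norm d)\<^sup>2\<close>.  All small step sizes are therefore accepted once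
  \<open>\<rho>1 < \<gamma> / 2\<close> and \<open>\<rho>1 < 1 / tmax\<close>; for larger \<open>\<rho>1\<close> the backtracking need not terminate.
\<close>

definition backtracking_step :: "real^'n \<Rightarrow> real^'n \<Rightarrow> real \<Rightarrow> bool" where
  "backtracking_step x d \<alpha> \<longleftrightarrow>
     (\<exists>m::nat. \<alpha> = \<rho>2 ^ m * \<alpha>init \<and> \<not> insufficient_decrease x d \<alpha> \<and>
              (\<forall>i<m. insufficient_decrease x d (\<rho>2 ^ i * \<alpha>init)))"

text \<open>
  One pass through the main loop.  In the case \<open>reject\<close> the counter stays at \<open>k\<close>, so the next pass
  starts from the overwritten \<open>x\<^sub>k\<close> with the same \<open>t\<^sub>k\<close> and recomputes \<open>t\<^bsub>k+1\<^esub>\<close>.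
\<close>

inductive rpn_step :: "(real^'n) rpn_state \<Rightarrow> (real^'n) rpn_state \<Rightarrow> bool" where
  line_search:
    "\<lbrakk> search_dir (t k) (x k) dk st; t' = t(Suc k := next_t (t k) (x k) dk st); d' = d(k := dk);
       st \<noteq> SupRes \<and> fl \<noteq> 1;
       backtracking_step (x k) dk \<alpha> \<rbrakk>
     \<Longrightarrow> rpn_step (State k fl x t d)
                  (State (Suc k) 0 (x(Suc k := R (x k) (\<alpha> *\<^sub>R dk))) t' d')"
| tentative:
    "\<lbrakk> search_dir (t k) (x k) dk st; t' = t(Suc k := next_t (t k) (x k) dk st); d' = d(k := dk);
       \<not> (st \<noteq> SupRes \<and> fl \<noteq> 1); fl + 1 = 1 \<rbrakk>
     \<Longrightarrow> rpn_step (State k fl x t d)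
                  (State (Suc k) (fl + 1) (x(Suc k := R (x k) dk)) t' d')"
| accept:
    "\<lbrakk> search_dir (t k) (x k) dk st; t' = t(Suc k := next_t (t k) (x k) dk st); d' = d(k := dk);
       \<not> (st \<noteq> SupRes \<and> fl \<noteq> 1); fl + 1 \<noteq> 1;
       \<not> F (R (x k) dk) > F (x (k - 1)) - \<rho>1 * (norm (pg_dir (t (k - 1)) (x (k - 1))))\<^sup>2 \<rbrakk>
     \<Longrightarrow> rpn_step (State k fl x t d)
                  (State (Suc k) 0 (x(Suc k := R (x k) dk)) t' d')"
| reject:
    "\<lbrakk> search_dir (t k) (x k) dk st; t' = t(Suc k := next_t (t k) (x k) dk st); d' = d(k := dk);
       \<not> (st \<noteq> SupRes \<and> fl \<noteq> 1); fl + 1 \<noteq> 1;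
       F (R (x k) dk) > F (x (k - 1)) - \<rho>1 * (norm (pg_dir (t (k - 1)) (x (k - 1))))\<^sup>2;
       backtracking_step (x (k - 1)) (d (k - 1)) \<alpha> \<rbrakk>
     \<Longrightarrow> rpn_step (State k fl x t d)
                  (State k 0 (x(Suc k := R (x k) dk, k := R (x (k - 1)) (\<alpha> *\<^sub>R d (k - 1)))) t' d')"

text \<open>
  The generated sequences consist of the final contents of \<open>x\<^sub>k\<close> and \<open>t\<^sub>k\<close>, after any overwriting.
\<close>

definition generates ::
  "real^'n \<Rightarrow> real \<Rightarrow> (nat \<Rightarrow> real^'n) \<Rightarrow> (nat \<Rightarrow> real) \<Rightarrow> bool" where
  "generates x0 t0 x t \<longleftrightarrow>
     (\<exists>\<sigma> :: nat \<Rightarrow> (real^'n) rpn_state.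
        iter (\<sigma> 0) = 0 \<and> flag (\<sigma> 0) = 0 \<and> xs (\<sigma> 0) 0 = x0 \<and> ts (\<sigma> 0) 0 = t0 \<and>
        (\<forall>m. rpn_step (\<sigma> m) (\<sigma> (Suc m))) \<and>
        (\<forall>k. \<forall>\<^sub>F m in sequentially. xs (\<sigma> m) k = x k \<and> ts (\<sigma> m) k = t k))"

end

end

theory Submission
  imports Defs
begin

text \<open>
  Every search direction \<open>d\<close> is tangent and has slope at most \<open>- c * (norm d)\<^sup>2\<close> with a fixed
  \<open>c > \<rho>1\<close>: for \<open>d = pg_dir t x\<close> this is the optimality condition of the proximal map, and otherwise it
  follows from the curvature and descent tests of tCG, in which the Weingarten term cancels.  Since
  \<open>R x u = x + u + O((norm u)\<^sup>2)\<close> uniformly on the compact \<open>M\<close>, backtracking step sizes are bounded below.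

  Group the passes of the main loop into rounds ending with flag 0.  If \<open>norm (pg_dir t x) \<ge> \<epsilon>\<close>
  from some point on, a round either decreases \<open>F\<close> by a fixed amount, or does not increase \<open>F\<close> and
  multiplies \<open>t > tmin\<close> by \<open>\<omega>2\<close> (down to at worst \<open>tmin\<close>).  The second kind cannot go on forever, as no
  such round starts at \<open>tmin\<close>, and the first kind cannot occur infinitely often, as \<open>F\<close> is bounded
  below on \<open>M\<close>.
\<close>

section \<open>Tangent spaces and retractions\<close>

lemma C_on_cong:
  assumes "open S" "\<And>x. x \<in> S \<Longrightarrow> f x = g x" "C_on k S f"
  shows "C_on k S g"
  using assms(2,3)
proof (induction k arbitrary: f g)
  case 0
  then show ?case using continuous_on_cong by (metis C_on.simps(1))
next
  case (Suc k)
  have der: "(g has_derivative frechet_derivative f (at x)) (at x)" if "x \<in> S" for x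
  proof -
    have "(f has_derivative frechet_derivative f (at x)) (at x)"
      using Suc.prems(2) that frechet_derivative_works by auto
    then show ?thesis
      using has_derivative_transform_within_open[OF _ \<open>open S\<close> that] Suc.prems(1) by blast
  qed
  then have eq: "frechet_derivative g (at x) = frechet_derivative f (at x)" if "x \<in> S" for x
    using that frechet_derivative_at by metis
  have "C_on k S (\<lambda>x. frechet_derivative g (at x) v)" for v
    by (rule Suc.IH[of "\<lambda>x. frechet_derivative f (at x) v"]) (use eq Suc.prems(2) in auto)
  moreover have "\<forall>x\<in>S. g differentiable (at x)"
    using der differentiable_def by blast
  ultimately show ?case by simp
qed

lemma C_on_Suc_has_derivative:
  assumes "C_on (Suc k) S g" "x \<in> S"
  shows "(g has_derivative frechet_derivative g (at x)) (at x)"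
  using assms by (simp add: frechet_derivative_works)

lemma smooth_on_has_derivative:
  assumes "smooth_on S g" "x \<in> S"
  shows "(g has_derivative frechet_derivative g (at x)) (at x)"
proof (rule C_on_Suc_has_derivative)
  show "C_on (Suc 0) S g" using assms(1) unfolding smooth_on_def by (rule spec)
qed fact

text \<open>Only affine inner maps are treated, because then the derivative is again a directional
  derivative of \<open>g\<close> along the same line, with the scaled direction
  \<open>v *\<^sub>R l\<close>. The induction closes without product or general chain rules.\<close>

lemma C_on_compose_line:
  fixes g :: "'a::real_normed_vector \<Rightarrow> 'b::real_normed_vector" and S :: "real set"
  assumes "open S" "\<And>s. s \<in> S \<Longrightarrow> q + s *\<^sub>R l \<in> V" "C_on k V g"
  shows "C_on k S (\<lambda>s. g (q + s *\<^sub>R l))"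
  using assms(3)
proof (induction k arbitrary: g)
  case 0
  then have "continuous_on V g" by simp
  then have "continuous_on S (\<lambda>s. g (q + s *\<^sub>R l))"
    by (rule continuous_on_compose2) (auto intro!: continuous_intros assms(2))
  then show ?case by simp
next
  case (Suc k)
  have der: "((\<lambda>s. g (q + s *\<^sub>R l)) has_derivative
      (\<lambda>v. frechet_derivative g (at (q + s *\<^sub>R l)) (v *\<^sub>R l))) (at s)" if "s \<in> S" for s
  proof -
    have g: "(g has_derivative frechet_derivative g (at (q + s *\<^sub>R l))) (at (q + s *\<^sub>R l))"
      using Suc.prems assms(2)[OF that] frechet_derivative_works by auto
    have "((\<lambda>s. q + s *\<^sub>R l) has_derivative (\<lambda>v. v *\<^sub>R l)) (at s)"
      by (auto intro!: derivative_eq_intros)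
    from has_derivative_compose[OF this g] show ?thesis .
  qed
  then have eq: "frechet_derivative (\<lambda>s. g (q + s *\<^sub>R l)) (at s)
      = (\<lambda>v. frechet_derivative g (at (q + s *\<^sub>R l)) (v *\<^sub>R l))" if "s \<in> S" for s
    using that frechet_derivative_at by metis
  have "C_on k S (\<lambda>s. frechet_derivative (\<lambda>s. g (q + s *\<^sub>R l)) (at s) v)" for v
  proof (rule C_on_cong[OF \<open>open S\<close>])
    show "C_on k S (\<lambda>s. frechet_derivative g (at (q + s *\<^sub>R l)) (v *\<^sub>R l))"
      by (rule Suc.IH) (use Suc.prems in simp)
  qed (simp add: eq)
  moreover have "\<forall>s\<in>S. (\<lambda>s. g (q + s *\<^sub>R l)) differentiable (at s)"
    using der differentiable_def by blast
  ultimately show ?case by simp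
qed

text \<open>\<open>C_on\<close> provides continuity of each directional derivative separately.
  Bounding the finitely many basis directions on the compact set and summing bounds the operator
  norm; convexity then allows the mean value inequality.\<close>

lemma C_on_1_lipschitz:
  fixes g :: "'a::euclidean_space \<Rightarrow> 'b::real_normed_vector"
  assumes "C_on 1 U g" "W \<subseteq> U" "compact W" "convex W"
  shows "\<exists>K\<ge>0. \<forall>y\<in>W. \<forall>z\<in>W. norm (g y - g z) \<le> K * norm (y - z)"
proof -
  have diff: "(g has_derivative frechet_derivative g (at y)) (at y)" if "y \<in> U" for y
    using assms(1) that frechet_derivative_works by (auto simp: One_nat_def)
  have "\<exists>C. \<forall>y\<in>W. norm (frechet_derivative g (at y) b) \<le> C" for b
  proof -
    have "continuous_on W (\<lambda>y. frechet_derivative g (at y) b)"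
      using assms(1) by (intro continuous_on_subset[OF _ assms(2)]) (simp add: One_nat_def)
    then have "bounded ((\<lambda>y. frechet_derivative g (at y) b) ` W)"
      using assms(3) compact_continuous_image compact_imp_bounded by blast
    then show ?thesis by (auto simp: bounded_iff)
  qed
  then obtain C where C: "\<And>b y. y \<in> W \<Longrightarrow> norm (frechet_derivative g (at y) b) \<le> C b"
    by metis
  define K where "K = (\<Sum>b\<in>Basis. \<bar>C b\<bar>)"
  have onorm: "onorm (frechet_derivative g (at y)) \<le> K" if "y \<in> W" for y
  proof (rule onorm_bound)
    show "K \<ge> 0" unfolding K_def by (simp add: sum_nonneg)
    fix v
    have lin: "linear (frechet_derivative g (at y))"
      using diff that assms(2) has_derivative_linear by blast
    have "frechet_derivative g (at y) v
        = frechet_derivative g (at y) (\<Sum>b\<in>Basis. (v \<bullet> b) *\<^sub>R b)"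
      by (simp add: euclidean_representation)
    also have "\<dots> = (\<Sum>b\<in>Basis. (v \<bullet> b) *\<^sub>R frechet_derivative g (at y) b)"
      by (simp add: linear_sum[OF lin] linear_cmul[OF lin])
    also have "norm \<dots> \<le> (\<Sum>b\<in>Basis. norm ((v \<bullet> b) *\<^sub>R frechet_derivative g (at y) b))"
      by (rule norm_sum)
    also have "\<dots> \<le> (\<Sum>b\<in>Basis. norm v * \<bar>C b\<bar>)"
    proof (rule sum_mono)
      fix b :: 'a assume b: "b \<in> Basis"
      show "norm ((v \<bullet> b) *\<^sub>R frechet_derivative g (at y) b) \<le> norm v * \<bar>C b\<bar>"
        using C[OF that, of b] Basis_le_norm[OF b, of v] by (auto intro!: mult_mono)
    qed
    also have "\<dots> = K * norm v"
      unfolding K_def by (simp add: sum_distrib_left mult.commute)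
    finally show "norm (frechet_derivative g (at y) v) \<le> K * norm v" .
  qed
  have "norm (g y - g z) \<le> K * norm (y - z)" if "y \<in> W" "z \<in> W" for y z
    by (rule differentiable_bound[OF assms(4) _ onorm])
       (use diff assms(2) that has_derivative_at_withinI in blast)+
  moreover have "K \<ge> 0" unfolding K_def by (simp add: sum_nonneg)
  ultimately show ?thesis by blast
qed

section \<open>Tangent spaces through slice charts\<close>

lemma has_vector_derivative_compose_has_derivative:
  assumes "(f has_vector_derivative f') (at x within S)" "(g has_derivative g') (at (f x))"
  shows "((\<lambda>s. g (f s)) has_vector_derivative g' f') (at x within S)"
  using vector_derivative_diff_chain_within[OF assms(1) has_derivative_at_withinI[OF assms(2)]]
  by (simp only: o_def)

text \<open>Velocities of curves do not visibly form a subspace. A slice chart straightens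
  \<open>M\<close> to \<open>L\<close>, where they do, and the differential of the inverse chart
  carries \<open>L\<close> back.\<close>

lemma tangent_space_eq_image:
  fixes M L :: "'a::euclidean_space set"
  assumes "open U" "p \<in> U" "p \<in> M" "open V" "homeomorphism U V \<Phi> \<Psi>"
    and "smooth_on U \<Phi>" "smooth_on V \<Psi>" "subspace L" "\<Phi> ` (U \<inter> M) = V \<inter> L"
  shows "tangent_space M p = frechet_derivative \<Psi> (at (\<Phi> p)) ` L"
proof -
  define q where "q = \<Phi> p"
  have q: "q \<in> V" "q \<in> L" "\<Psi> q = p"
    using assms(2,3,5,9) by (auto simp: q_def homeomorphism_def)
  have D\<Psi>: "(\<Psi> has_derivative frechet_derivative \<Psi> (at q)) (at q)"
    using assms(7) q(1) by (rule smooth_on_has_derivative)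
  have D\<Phi>: "(\<Phi> has_derivative frechet_derivative \<Phi> (at p)) (at p)"
    using assms(6,2) by (rule smooth_on_has_derivative)
  show ?thesis unfolding q_def[symmetric]
  proof (intro equalityI subsetI)
    \<comment> \<open>The inverse chart maps the straight segment through \<open>q\<close> in
      direction \<open>l\<close> to a smooth curve in \<open>M\<close> with velocity
      \<open>v\<close>.\<close>
    fix v assume "v \<in> frechet_derivative \<Psi> (at q) ` L"
    then obtain l where l: "l \<in> L" "v = frechet_derivative \<Psi> (at q) l" by blast
    have "open ((\<lambda>s::real. q + s *\<^sub>R l) -` V)"
      by (rule open_vimage[OF \<open>open V\<close>]) (intro continuous_intros)
    then obtain e where e: "e > 0" "ball 0 e \<subseteq> (\<lambda>s::real. q + s *\<^sub>R l) -` V"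
      using q(1) open_contains_ball_eq[of "(\<lambda>s::real. q + s *\<^sub>R l) -` V" 0] by auto
    have eV: "q + s *\<^sub>R l \<in> V" if "s \<in> {-e<..<e}" for s
      using e(2) that by (auto simp: subset_iff dist_real_def)
    define c where "c s = \<Psi> (q + s *\<^sub>R l)" for s
    have "smooth_on {-e<..<e} c"
      unfolding smooth_on_def c_def
      using C_on_compose_line[of "{-e<..<e}" q l V] eV assms(7)
      by (auto simp: smooth_on_def)
    moreover have "c ` {-e<..<e} \<subseteq> M"
    proof clarify
      fix s assume "s \<in> {-e<..<e}"
      then have "q + s *\<^sub>R l \<in> V \<inter> L"
        using eV q(2) l(1) assms(8) by (simp add: subspace_add subspace_scale)
      then obtain z where "z \<in> U \<inter> M" "q + s *\<^sub>R l = \<Phi> z" using assms(9) by blast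
      then show "c s \<in> M" using assms(5) by (auto simp: c_def homeomorphism_def)
    qed
    moreover have "c 0 = p" by (simp add: c_def q)
    moreover have "(c has_vector_derivative v) (at 0)"
    proof -
      have "((\<lambda>s::real. q + s *\<^sub>R l) has_derivative (\<lambda>s. s *\<^sub>R l)) (at 0)"
        by (auto intro!: derivative_eq_intros)
      from has_derivative_compose[OF this, of \<Psi> "frechet_derivative \<Psi> (at q)"]
      have "(c has_derivative (\<lambda>s. frechet_derivative \<Psi> (at q) (s *\<^sub>R l))) (at 0)"
        using D\<Psi> by (simp add: c_def[abs_def])
      then show ?thesis
        unfolding has_vector_derivative_def l(2)
        using linear_cmul[OF has_derivative_linear[OF D\<Psi>]] by simp
    qed
    ultimately show "v \<in> tangent_space M p"
      unfolding tangent_space_def using e(1) by blast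
  next
    \<comment> \<open>Conversely, the chart maps a curve in \<open>M\<close> into \<open>L\<close>
      near time 0. Its velocity \<open>l\<close> is orthogonal to the complement of
      \<open>L\<close>, hence lies in \<open>L\<close>, and is mapped back to
      \<open>v\<close>.\<close>
    fix v assume "v \<in> tangent_space M p"
    then obtain e c where c: "e > 0" "c ` {-e<..<e} \<subseteq> M" "c 0 = p"
        "(c has_vector_derivative v) (at 0)"
      unfolding tangent_space_def by blast
    define l where "l = frechet_derivative \<Phi> (at p) v"
    have "isCont c 0" using c(4) has_vector_derivative_continuous by blast
    then have "\<forall>\<^sub>F s in at 0. c s \<in> U"
      using topological_tendstoD[of c "c 0" "at 0" U] assms(1,2) c(3) by (simp add: isCont_def)
    then obtain d where d0: "d > 0" "\<And>s. s \<noteq> 0 \<Longrightarrow> \<bar>s\<bar> < d \<Longrightarrow> c s \<in> U"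
      unfolding eventually_at by (auto simp: dist_real_def)
    have d: "c s \<in> U" if "\<bar>s\<bar> < d" for s
      by (cases "s = 0") (use that d0(2) assms(2) c(3) in auto)
    define S where "S = {- min d e<..<min d e}"
    have S: "open S" "0 \<in> S" using c(1) d0(1) by (auto simp: S_def)
    have cU: "c s \<in> U \<inter> M" if "s \<in> S" for s
    proof -
      have "s \<in> {-e<..<e}" "\<bar>s\<bar> < d" using that by (auto simp: S_def)
      then show ?thesis using c(2) d by blast
    qed
    have d1: "((\<lambda>s. \<Phi> (c s)) has_vector_derivative l) (at 0)"
      unfolding l_def
      by (rule has_vector_derivative_compose_has_derivative[OF c(4)]) (use c(3) D\<Phi> in simp)
    have "l \<bullet> y = 0" if "y \<in> orthogonal_comp L" for y
    proof -
      have "((\<lambda>s. \<Phi> (c s) \<bullet> y) has_vector_derivative l \<bullet> y) (at 0)"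
        using bounded_linear.has_vector_derivative[OF bounded_linear_inner_left d1] .
      moreover have "((\<lambda>s. \<Phi> (c s) \<bullet> y) has_vector_derivative 0) (at 0)"
      proof (rule has_vector_derivative_transform_within_open[of "\<lambda>_. 0" _ _ S])
        fix s assume "s \<in> S"
        then have "\<Phi> (c s) \<in> L" using cU assms(9) by blast
        then show "0 = \<Phi> (c s) \<bullet> y"
          using that by (auto simp: orthogonal_comp_def orthogonal_def)
      qed (use S in auto)
      ultimately show ?thesis by (rule vector_derivative_unique_at)
    qed
    then have "l \<in> orthogonal_comp (orthogonal_comp L)"
      by (auto simp: orthogonal_comp_def orthogonal_def inner_commute)
    then have l: "l \<in> L" using orthogonal_comp_self assms(8) by metis
    have "((\<lambda>s. \<Psi> (\<Phi> (c s))) has_vector_derivative frechet_derivative \<Psi> (at q) l) (at 0)"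
      by (rule has_vector_derivative_compose_has_derivative[OF d1]) (use c(3) D\<Psi> in \<open>simp add: q_def\<close>)
    moreover have "((\<lambda>s. \<Psi> (\<Phi> (c s))) has_vector_derivative v) (at 0)"
    proof (rule has_vector_derivative_transform_within_open[OF c(4) S])
      show "c s = \<Psi> (\<Phi> (c s))" if "s \<in> S" for s
        using cU[OF that] assms(5) by (auto simp: homeomorphism_def)
    qed
    ultimately have "frechet_derivative \<Psi> (at q) l = v"
      by (rule vector_derivative_unique_at)
    then show "v \<in> frechet_derivative \<Psi> (at q) ` L" using l by blast
  qed
qed

lemma subspace_tangent_space:
  fixes M :: "'a::euclidean_space set"
  assumes "embedded_submanifold M m" "p \<in> M"
  shows "subspace (tangent_space M p)"
proof -
  have "\<exists>U V (\<Phi>::'a \<Rightarrow> 'a) \<Psi> L. open U \<and> p \<in> U \<and> open V \<and> homeomorphism U V \<Phi> \<Psi> \<and>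
      smooth_on U \<Phi> \<and> smooth_on V \<Psi> \<and> subspace L \<and> dim L = m \<and> \<Phi> ` (U \<inter> M) = V \<inter> L"
    using assms(1)[unfolded embedded_submanifold_def] assms(2) by (rule bspec)
  then obtain U V L and \<Phi> \<Psi> :: "'a \<Rightarrow> 'a" where *: "open U" "p \<in> U" "open V"
    "homeomorphism U V \<Phi> \<Psi>" "smooth_on U \<Phi>" "smooth_on V \<Psi>" "subspace L"
    "\<Phi> ` (U \<inter> M) = V \<inter> L"
    by (elim exE conjE) (rule that)
  have "\<Phi> p \<in> V" using *(2,4) by (auto simp: homeomorphism_def)
  from has_derivative_linear[OF smooth_on_has_derivative[OF *(6) this]]
  show ?thesis
    unfolding tangent_space_eq_image[OF *(1,2) assms(2) *(3-8)]
    using *(7) by (rule linear_subspace_image)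
qed

text \<open>Extend the retraction smoothly to \<open>g\<close> near \<open>(p, 0)\<close>. Its
  derivative in the fibre direction is the identity on tangent vectors at \<open>(x, 0)\<close> and
  is Lipschitz nearby, so the error of the first-order expansion is quadratic, uniformly in the base
  point.\<close>

lemma retraction_local_second_order:
  fixes M :: "'a::euclidean_space set"
  assumes R: "riem_retraction M R" and T: "\<And>x. x \<in> M \<Longrightarrow> subspace (tangent_space M x)"
    and p: "p \<in> M"
  shows "\<exists>r>0. \<exists>K\<ge>0. \<forall>x\<in>M \<inter> ball p r. \<forall>u\<in>tangent_space M x.
           norm u \<le> r \<longrightarrow> norm (R x u - x - u) \<le> K * (norm u)\<^sup>2"
proof -
  have "(p, 0) \<in> tangent_bundle M"
    using p T subspace_0 by (auto simp: tangent_bundle_def)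
  then obtain U g where U: "open U" "(p, 0) \<in> U" and g: "smooth_on U g"
      and gR: "\<And>q. q \<in> tangent_bundle M \<inter> U \<Longrightarrow> g q = (\<lambda>(x, v). R x v) q"
    using R unfolding riem_retraction_def smooth_map_on_def by metis
  have "\<exists>r>0. cball p r \<times> cball 0 r \<subseteq> U"
  proof -
    obtain A C where AC: "open A" "open C" "(p, 0) \<in> A \<times> C" "A \<times> C \<subseteq> U"
      using open_prod_elim[OF U] by blast
    obtain a c where "a > 0" "cball p a \<subseteq> A" "c > 0" "cball 0 c \<subseteq> C"
      using AC open_contains_cball by (metis mem_Sigma_iff)
    then show ?thesis using AC(4)
      by (intro exI[of _ "min a c"]) (auto simp: subset_iff)
  qed
  then obtain r where r: "r > 0" "cball p r \<times> cball 0 r \<subseteq> U" by blast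
  \<comment> \<open>A product of closed balls is compact and convex, as the Lipschitz bound on the
    derivatives requires.\<close>
  define W where "W = cball p r \<times> cball (0::'a) r"
  define D where "D y v = frechet_derivative g (at y) v" for y v
  have W: "W \<subseteq> U" "compact W" "convex W"
    unfolding W_def using r(2) by (auto intro!: compact_Times convex_Times)
  have C2: "C_on (Suc (Suc 0)) U g" using g unfolding smooth_on_def by (rule spec)
  then have Dg: "(g has_derivative D y) (at y)" if "y \<in> U" for y
    using C_on_Suc_has_derivative[OF C2 that] by (simp add: D_def[abs_def])
  have "\<exists>K\<ge>0. \<forall>y\<in>W. \<forall>z\<in>W. norm (D y (0, b) - D z (0, b)) \<le> K * norm (y - z)" for b
  proof (rule C_on_1_lipschitz[OF _ W])
    show "C_on 1 U (\<lambda>y. D y (0, b))"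
      using C2 unfolding C_on.simps(2)[of "Suc 0" U g] One_nat_def D_def by blast
  qed
  then obtain k where k: "\<And>b. k b \<ge> 0"
      "\<And>b y z. y \<in> W \<Longrightarrow> z \<in> W \<Longrightarrow> norm (D y (0, b) - D z (0, b)) \<le> k b * norm (y - z)"
    by metis
  define K where "K = (\<Sum>b\<in>Basis. k b)"
  have K: "K \<ge> 0" unfolding K_def using k(1) by (simp add: sum_nonneg)
  have "norm (R x u - x - u) \<le> K * (norm u)\<^sup>2"
    if x: "x \<in> M" "x \<in> ball p r" and u: "u \<in> tangent_space M x" "norm u \<le> r" for x u
  proof -
    have sW: "(x, s *\<^sub>R u) \<in> W" if "s \<in> {0..1}" for s :: real
      using x(2) u(2) that mult_le_one[of s "norm u / r"] r(1)
      by (auto simp: W_def intro: order_trans[OF mult_left_le_one_le])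
    have sg: "g (x, s *\<^sub>R u) = R x (s *\<^sub>R u)" if "s \<in> {0..1}" for s
      using gR[of "(x, s *\<^sub>R u)"] sW[OF that] W(1) x(1) u(1) T[OF x(1)] subspace_scale
      by (auto simp: tangent_bundle_def)
    have d\<phi>: "((\<lambda>s::real. g (x, s *\<^sub>R u)) has_vector_derivative D (x, s *\<^sub>R u) (0, u)) (at s within {0..1})"
      if "s \<in> {0..1}" for s
    proof -
      have "((\<lambda>s::real. (x, s *\<^sub>R u)) has_vector_derivative (0, u)) (at s within {0..1})"
        unfolding has_vector_derivative_def by (auto intro!: derivative_eq_intros)
      then show ?thesis
        by (rule has_vector_derivative_compose_has_derivative) (use Dg sW[OF that] W(1) in blast)
    qed
    \<comment> \<open>The retraction axiom gives the derivative only within the tangent space, while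
      \<open>D\<close> belongs to the extension \<open>g\<close>. Both maps agree along the ray
      through \<open>u\<close>, so their one-sided velocities at 0 coincide.\<close>
    have D0: "D (x, 0) (0, u) = u"
    proof -
      have "(R x has_derivative (\<lambda>v. v)) (at 0 within tangent_space M x)"
        using R x(1) by (auto simp: riem_retraction_def)
      then have "(R x has_derivative (\<lambda>v. v)) (at (0 *\<^sub>R u) within (\<lambda>s. s *\<^sub>R u) ` {0..1::real})"
        using u(1) T[OF x(1)] subspace_scale
        by (auto intro: has_derivative_subset)
      moreover have lin: "((\<lambda>s::real. s *\<^sub>R u) has_vector_derivative u) (at 0 within {0..1})"
        unfolding has_vector_derivative_def by (auto intro!: derivative_eq_intros)
      ultimately have "((\<lambda>s::real. R x (s *\<^sub>R u)) has_vector_derivative u) (at 0 within {0..1})"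
        using vector_derivative_diff_chain_within[of "\<lambda>s::real. s *\<^sub>R u" u 0 "{0..1}" "R x" "\<lambda>v. v"]
          lin by (auto simp: o_def)
      then have g0: "((\<lambda>s::real. g (x, s *\<^sub>R u)) has_vector_derivative u) (at 0 within {0..1})"
        by (rule has_vector_derivative_transform[rotated 2]) (auto simp: sg)
      have g1: "((\<lambda>s::real. g (x, s *\<^sub>R u)) has_vector_derivative D (x, 0) (0, u)) (at 0 within {0..1})"
        using d\<phi>[of 0] by simp
      show ?thesis
        by (rule vector_derivative_unique_within[OF _ g1 g0]) (simp add: trivial_limit_within)
    qed
    \<comment> \<open>One factor \<open>norm u\<close> comes from the coefficients of
      \<open>u\<close> in the basis, the other from the distance between
      \<open>(x, s *\<^sub>R u)\<close> and \<open>(x, 0)\<close>.\<close>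
    have Dbound: "norm (D (x, s *\<^sub>R u) (0, u) - u) \<le> K * (norm u)\<^sup>2" if s: "s \<in> {0..1}" for s
    proof -
      have expand: "D y (0, u) = (\<Sum>b\<in>Basis. (u \<bullet> b) *\<^sub>R D y (0, b))" if "y \<in> U" for y
      proof -
        have lin: "linear (D y)" using Dg[OF that] has_derivative_linear by blast
        have "(0, u) = (\<Sum>b\<in>Basis. (u \<bullet> b) *\<^sub>R (0::'a, b))"
          by (rule prod_eqI) (auto simp: fst_sum snd_sum euclidean_representation)
        then have "D y (0, u) = D y (\<Sum>b\<in>Basis. (u \<bullet> b) *\<^sub>R (0, b))" by simp
        also have "\<dots> = (\<Sum>b\<in>Basis. (u \<bullet> b) *\<^sub>R D y (0, b))"
          by (simp only: linear_sum[OF lin] linear_cmul[OF lin])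
        finally show ?thesis .
      qed
      have in_W: "(x, s *\<^sub>R u) \<in> W" "(x, 0) \<in> W" using sW[OF s] sW[of 0] by auto
      have D_diff: "D (x, s *\<^sub>R u) (0, u) - u = (\<Sum>b\<in>Basis. (u \<bullet> b) *\<^sub>R (D (x, s *\<^sub>R u) (0, b) - D (x, 0) (0, b)))"
        using expand[of "(x, s *\<^sub>R u)"] expand[of "(x, 0)"] in_W W(1) D0
        by (simp add: subset_iff sum_subtractf algebra_simps)
      have "norm (D (x, s *\<^sub>R u) (0, u) - u) \<le> (\<Sum>b\<in>Basis. norm ((u \<bullet> b) *\<^sub>R (D (x, s *\<^sub>R u) (0, b) - D (x, 0) (0, b))))"
        unfolding D_diff by (rule norm_sum)
      also have "\<dots> \<le> (\<Sum>b\<in>Basis. norm u * (k b * norm u))"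
      proof (rule sum_mono)
        fix b :: 'a assume b: "b \<in> Basis"
        have "norm (D (x, s *\<^sub>R u) (0, b) - D (x, 0) (0, b)) \<le> k b * norm ((x, s *\<^sub>R u) - (x, 0))"
          by (rule k(2)) (use in_W in auto)
        also have "\<dots> \<le> k b * norm u"
          using s k(1) by (intro mult_left_mono) (auto simp: norm_Pair mult_left_le_one_le)
        finally show "norm ((u \<bullet> b) *\<^sub>R (D (x, s *\<^sub>R u) (0, b) - D (x, 0) (0, b)))
            \<le> norm u * (k b * norm u)"
          using Basis_le_norm[OF b, of u] by (auto intro!: mult_mono)
      qed
      also have "\<dots> = K * (norm u)\<^sup>2"
        by (simp add: K_def sum_distrib_left sum_distrib_right power2_eq_square mult_ac)
      finally show ?thesis .
    qed
    \<comment> \<open>Mean value inequality for \<open>g (x, s *\<^sub>R u) - s *\<^sub>R u\<close>,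
      which takes the values \<open>R x u - u\<close> at 1 and \<open>x\<close> at 0.\<close>
    have "norm ((g (x, 1 *\<^sub>R u) - 1 *\<^sub>R u) - (g (x, 0 *\<^sub>R u) - 0 *\<^sub>R u))
        \<le> K * (norm u)\<^sup>2 * norm (1 - 0 :: real)"
    proof (rule differentiable_bound[where S = "{0..1::real}"
          and f' = "\<lambda>s h. h *\<^sub>R (D (x, s *\<^sub>R u) (0, u) - u)"])
      fix s :: real assume s: "s \<in> {0..1}"
      show "((\<lambda>s. g (x, s *\<^sub>R u) - s *\<^sub>R u) has_derivative
          (\<lambda>h. h *\<^sub>R (D (x, s *\<^sub>R u) (0, u) - u))) (at s within {0..1})"
        using d\<phi>[OF s] unfolding has_vector_derivative_def
        by (auto intro!: derivative_eq_intros simp: algebra_simps)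
      show "onorm (\<lambda>h. h *\<^sub>R (D (x, s *\<^sub>R u) (0, u) - u)) \<le> K * (norm u)\<^sup>2"
        using Dbound[OF s] by (intro onorm_bound) (auto simp: K mult.commute intro: mult_left_mono)
    qed auto
    moreover have "R x 0 = x" using R x(1) by (auto simp: riem_retraction_def)
    ultimately show ?thesis using sg[of 1] sg[of 0] by (simp add: algebra_simps)
  qed
  then show ?thesis using r(1) K by blast
qed

text \<open>Compactness of \<open>M\<close> leaves finitely many local constants. For vectors longer
  than the local radius the left side is at most a constant plus \<open>norm u\<close>, since
  \<open>R x u\<close> stays in the bounded set \<open>M\<close>, and both terms are dominated by
  the square.\<close>

lemma retraction_second_order:
  fixes M :: "'a::euclidean_space set"
  assumes R: "riem_retraction M R" and T: "\<And>x. x \<in> M \<Longrightarrow> subspace (tangent_space M x)"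
    and M: "compact M"
  shows "\<exists>K\<ge>0. \<forall>x\<in>M. \<forall>u\<in>tangent_space M x. norm (R x u - x - u) \<le> K * (norm u)\<^sup>2"
proof -
  have "\<forall>p\<in>M. \<exists>r K. r > 0 \<and> K \<ge> 0 \<and> (\<forall>x\<in>M \<inter> ball p r. \<forall>u\<in>tangent_space M x.
           norm u \<le> r \<longrightarrow> norm (R x u - x - u) \<le> K * (norm u)\<^sup>2)"
    using retraction_local_second_order[OF R T] by blast
  then obtain r K where rK: "\<And>p. p \<in> M \<Longrightarrow> r p > 0" "\<And>p. p \<in> M \<Longrightarrow> K p \<ge> 0"
      "\<And>p x u. p \<in> M \<Longrightarrow> x \<in> M \<inter> ball p (r p) \<Longrightarrow> u \<in> tangent_space M x \<Longrightarrow>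
           norm u \<le> r p \<Longrightarrow> norm (R x u - x - u) \<le> K p * (norm u)\<^sup>2"
    by metis
  obtain P where P: "P \<subseteq> M" "finite P" "M \<subseteq> (\<Union>p\<in>P. ball p (r p))"
    using compactE_image[OF M, of M "\<lambda>p. ball p (r p)"] rK(1) by force
  obtain b where b: "\<And>y. y \<in> M \<Longrightarrow> norm y \<le> b"
    using compact_imp_bounded[OF M] by (auto simp: bounded_iff)
  \<comment> \<open>The two added terms absorb \<open>2 * \<bar>b\<bar>\<close> and
    \<open>norm u\<close> when \<open>norm u > r p\<close>. Summing over the finite cover below
    replaces taking a maximum.\<close>
  define K' where "K' p = K p + (2 * \<bar>b\<bar> / (r p)\<^sup>2 + 1 / r p)" for p
  have K': "K' p \<ge> 0" if "p \<in> M" for p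
    using rK(1,2)[OF that] by (auto simp: K'_def)
  have "norm (R x u - x - u) \<le> (\<Sum>p\<in>P. K' p) * (norm u)\<^sup>2"
    if x: "x \<in> M" and u: "u \<in> tangent_space M x" for x u
  proof -
    obtain p where p: "p \<in> P" "p \<in> M" "x \<in> ball p (r p)" using P x by blast
    note r = rK(1)[OF p(2)]
    have "norm (R x u - x - u) \<le> K' p * (norm u)\<^sup>2"
    proof (cases "norm u \<le> r p")
      case True
      then have "norm (R x u - x - u) \<le> K p * (norm u)\<^sup>2" using rK(3) p x u by blast
      also have "\<dots> \<le> K' p * (norm u)\<^sup>2"
        using r by (intro mult_right_mono) (auto simp: K'_def)
      finally show ?thesis .
    next
      case False
      have "R x u \<in> M" using R x u by (auto simp: riem_retraction_def tangent_bundle_def)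
      then have "norm (R x u - x - u) \<le> 2 * \<bar>b\<bar> + norm u"
        using b[of "R x u"] b[OF x] norm_triangle_ineq4[of "R x u - x" u]
          norm_triangle_ineq4[of "R x u" x] by linarith
      moreover have "2 * \<bar>b\<bar> \<le> 2 * \<bar>b\<bar> / (r p)\<^sup>2 * (norm u)\<^sup>2"
      proof -
        have "1 \<le> (norm u / r p)\<^sup>2" using False r by (intro one_le_power) auto
        then show ?thesis using mult_left_mono[of 1 "(norm u / r p)\<^sup>2" "2 * \<bar>b\<bar>"]
          by (simp add: power_divide)
      qed
      moreover have "norm u \<le> 1 / r p * (norm u)\<^sup>2"
        using False r mult_left_mono[of "r p" "norm u" "norm u"]
        by (simp add: field_simps power2_eq_square)
      ultimately have "norm (R x u - x - u) \<le> (2 * \<bar>b\<bar> / (r p)\<^sup>2 + 1 / r p) * (norm u)\<^sup>2"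
        unfolding distrib_right by linarith
      also have "\<dots> \<le> K' p * (norm u)\<^sup>2"
        using rK(2)[OF p(2)] by (intro mult_right_mono) (auto simp: K'_def)
      finally show ?thesis .
    qed
    also have "\<dots> \<le> (\<Sum>p\<in>P. K' p) * (norm u)\<^sup>2"
      using p(1) P K' by (intro mult_right_mono member_le_sum) auto
    finally show ?thesis .
  qed
  moreover have "(\<Sum>p\<in>P. K' p) \<ge> 0" using K' P(1) by (auto intro: sum_nonneg)
  ultimately show ?thesis by blast
qed

section \<open>Pseudoinverse, proximal map, gradient\<close>

text \<open>Take any right inverse \<open>G\<close> of \<open>A\<close> on its range and sandwich it
  between the orthogonal projections \<open>Pr\<close> onto the complement of the kernel and
  \<open>Pc\<close> onto the range. Then \<open>A ** X = Pc\<close> and \<open>X ** A = Pr\<close>,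
  and the four Penrose identities follow.\<close>

lemma pinv_exists:
  fixes A :: "real^'c^'n"
  shows "\<exists>X. A ** X ** A = A \<and> X ** A ** X = X \<and>
             transpose (A ** X) = A ** X \<and> transpose (X ** A) = X ** A"
proof -
  \<comment> \<open>Orthogonal projection onto a subspace, realized as a symmetric matrix.\<close>
  have proj: "\<exists>P::real^'k^'k. transpose P = P \<and> (\<forall>u. P *v u \<in> S) \<and> (\<forall>u\<in>S. P *v u = u) \<and>
      (\<forall>u. u - P *v u \<in> orthogonal_comp S)" if S: "subspace S" for S :: "(real^'k) set"
  proof -
    have "\<exists>y. y \<in> S \<and> u - y \<in> orthogonal_comp S" for u
    proof -
      obtain y z where "y \<in> span S" "\<And>w. w \<in> span S \<Longrightarrow> orthogonal z w" "u = y + z"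
        using orthogonal_subspace_decomp_exists by blast
      then show ?thesis
        using S by (intro exI[of _ y]) (auto simp: span_eq_iff[THEN iffD2] orthogonal_comp_def orthogonal_commute)
    qed
    then obtain p where p: "\<And>u. p u \<in> S" "\<And>u. u - p u \<in> orthogonal_comp S" by metis
    have uniq: "p u = y" if "y \<in> S" "u - y \<in> orthogonal_comp S" for u y
    proof -
      have "p u - y \<in> S" using p(1) that(1) S subspace_diff by blast
      moreover have "(u - y) - (u - p u) \<in> orthogonal_comp S"
        using p(2) that(2) subspace_orthogonal_comp subspace_diff by blast
      ultimately have "orthogonal (p u - y) (p u - y)"
        unfolding orthogonal_comp_def by (simp add: algebra_simps)
      then show ?thesis by (simp add: orthogonal_self)
    qed
    have lin: "linear p"
    proof (rule linearI)
      fix u v r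
      show "p (u + v) = p u + p v"
      proof (rule uniq)
        show "p u + p v \<in> S" using p(1) S subspace_add by blast
        have "(u - p u) + (v - p v) \<in> orthogonal_comp S"
          using p(2) subspace_orthogonal_comp subspace_add by blast
        then show "u + v - (p u + p v) \<in> orthogonal_comp S" by (simp add: algebra_simps)
      qed
      show "p (r *\<^sub>R u) = r *\<^sub>R p u"
      proof (rule uniq)
        show "r *\<^sub>R p u \<in> S" using p(1) S subspace_scale by blast
        have "r *\<^sub>R (u - p u) \<in> orthogonal_comp S"
          using p(2) subspace_orthogonal_comp subspace_scale by blast
        then show "r *\<^sub>R u - r *\<^sub>R p u \<in> orthogonal_comp S" by (simp add: algebra_simps)
      qed
    qed
    have sym: "p u \<bullet> v = u \<bullet> p v" for u v
    proof -
      have "p u \<bullet> (v - p v) = 0" "p v \<bullet> (u - p u) = 0"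
        using p by (auto simp: orthogonal_comp_def orthogonal_def)
      then show ?thesis by (simp add: inner_diff_right inner_commute)
    qed
    have mat: "matrix p *v u = p u" for u using lin by (simp add: matrix_works)
    have "transpose (matrix p) = matrix p"
    proof (rule matrix_eq[THEN iffD2], rule allI)
      fix u
      have "\<forall>v. v \<bullet> (transpose (matrix p) *v u) = v \<bullet> (matrix p *v u)"
        by (metis dot_lmul_matrix mat sym vector_transpose_matrix inner_commute)
      then show "transpose (matrix p) *v u = matrix p *v u"
        using vector_eq_ldot by blast
    qed
    moreover have "p u = u" if "u \<in> S" for u
      by (rule uniq) (use that subspace_0[OF subspace_orthogonal_comp] in auto)
    ultimately show ?thesis using p mat by (intro exI[of _ "matrix p"]) auto
  qed
  have linA: "linear ((*v) A)" by simp
  obtain g where g: "linear g" "\<forall>v\<in>range ((*v) A). A *v g v = v"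
    using linear_exists_right_inverse_on[OF linA subspace_UNIV] by auto
  define G where "G = matrix g"
  have G: "A *v (G *v (A *v u)) = A *v u" for u
    using g by (simp add: G_def matrix_works)
  have sub: "subspace (range ((*v) A))"
    using linear_subspace_image[OF linA subspace_UNIV] .
  obtain Pc where Pc: "transpose Pc = Pc" "\<And>u. Pc *v u \<in> range ((*v) A)"
      "\<And>u. Pc *v (A *v u) = A *v u"
    using proj[OF sub] by blast
  define N where "N = orthogonal_comp {u. A *v u = 0}"
  have sub0: "subspace {u. A *v u = 0}"
    by (auto simp: subspace_def matrix_vector_right_distrib matrix_vector_mult_scaleR)
  have subN: "subspace N" unfolding N_def by (rule subspace_orthogonal_comp)
  obtain Pr where Pr: "transpose Pr = Pr" "\<And>u. Pr *v u \<in> N" "\<And>u. u \<in> N \<Longrightarrow> Pr *v u = u"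
      "\<And>u. u - Pr *v u \<in> orthogonal_comp N"
    using proj[OF subN] by blast
  have NN: "orthogonal_comp N = {u. A *v u = 0}"
    unfolding N_def by (rule orthogonal_comp_self[OF sub0])
  have APr: "A *v (Pr *v u) = A *v u" for u
    using Pr(4)[of u] by (simp add: NN matrix_vector_mult_diff_distrib)
  have Pr0: "Pr *v u = 0" if "A *v u = 0" for u
  proof -
    have "A *v (Pr *v u) = 0" using APr that by simp
    then have "Pr *v u \<in> orthogonal_comp N" by (simp add: NN)
    then have "orthogonal (Pr *v u) (Pr *v u)"
      using Pr(2)[of u] unfolding orthogonal_comp_def by blast
    then show ?thesis by (simp add: orthogonal_self)
  qed
  define X where "X = Pr ** G ** Pc"
  have AX: "A ** X = Pc"
  proof (rule matrix_eq[THEN iffD2], rule allI)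
    fix u
    obtain z where z: "Pc *v u = A *v z" using Pc(2)[of u] by blast
    show "(A ** X) *v u = Pc *v u"
      by (simp add: X_def matrix_vector_mul_assoc[symmetric] z APr G)
  qed
  have XA: "X ** A = Pr"
  proof (rule matrix_eq[THEN iffD2], rule allI)
    fix u
    have "Pr *v (G *v (A *v u) - u) = 0"
      by (rule Pr0) (simp add: matrix_vector_mult_diff_distrib G)
    then show "(X ** A) *v u = Pr *v u"
      by (simp add: X_def matrix_vector_mul_assoc[symmetric] Pc(3) matrix_vector_mult_diff_distrib)
  qed
  have "A ** X ** A = A"
    unfolding AX by (rule matrix_eq[THEN iffD2]) (simp add: matrix_vector_mul_assoc[symmetric] Pc(3))
  moreover have "X ** A ** X = X"
    unfolding XA by (rule matrix_eq[THEN iffD2])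
      (simp add: X_def matrix_vector_mul_assoc[symmetric] Pr(2,3))
  ultimately show ?thesis using AX XA Pc(1) Pr(1) by auto
qed

text \<open>Symmetry of the products lets transposition swap the factors: \<open>A ** X\<close> is
  the transpose of \<open>A ** Y ** (A ** X)\<close>, hence equals
  \<open>A ** X ** (A ** Y) = A ** Y\<close>; likewise on the other side.\<close>

lemma pinv_unique:
  fixes A :: "real^'c^'n"
  assumes X: "A ** X ** A = A" "X ** A ** X = X" "transpose (A ** X) = A ** X" "transpose (X ** A) = X ** A"
    and Y: "A ** Y ** A = A" "Y ** A ** Y = Y" "transpose (A ** Y) = A ** Y" "transpose (Y ** A) = Y ** A"
  shows "X = Y"
proof -
  have AXY: "A ** X = A ** Y"
  proof -
    have "A ** X = transpose (A ** Y ** (A ** X))"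
      using X(3) Y(1) by (simp add: matrix_mul_assoc)
    also have "\<dots> = A ** X ** (A ** Y)"
      by (simp only: matrix_transpose_mul[of "A ** Y" "A ** X"] X(3) Y(3))
    finally show ?thesis using X(1) by (simp add: matrix_mul_assoc)
  qed
  have XYA: "X ** A = Y ** A"
  proof -
    have "X ** A = transpose (X ** A ** (Y ** A))"
      using X(4) Y(1) by (metis matrix_mul_assoc)
    also have "\<dots> = Y ** A ** (X ** A)"
      by (simp only: matrix_transpose_mul[of "X ** A" "Y ** A"] X(4) Y(4))
    finally show ?thesis using X(1) by (metis matrix_mul_assoc)
  qed
  have "X = X ** (A ** X)" using X(2) by (simp add: matrix_mul_assoc)
  also have "\<dots> = Y ** A ** Y" unfolding AXY by (simp add: matrix_mul_assoc XYA)
  finally show ?thesis using Y(2) by simp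
qed

text \<open>Transpose of the first Penrose identity, using symmetry of \<open>A ** pinv A\<close>.
  It makes the projection inside tCG land in the kernel of the transposed block.\<close>

lemma transpose_mult_pinv:
  fixes A :: "real^'c^'n"
  shows "transpose A ** (A ** pinv A) = transpose A"
proof -
  have "\<exists>!X. A ** X ** A = A \<and> X ** A ** X = X \<and>
             transpose (A ** X) = A ** X \<and> transpose (X ** A) = X ** A"
    using pinv_exists[of A] by (metis pinv_unique)
  from theI'[OF this]
  have p: "A ** pinv A ** A = A" "transpose (A ** pinv A) = A ** pinv A"
    unfolding pinv_def by auto
  have "transpose A = transpose (A ** pinv A ** A)" by (simp only: p(1))
  then show ?thesis by (simp only: matrix_transpose_mul[of "A ** pinv A"] p(2))
qed

text \<open>The problem separates by coordinates. With \<open>p\<close> the prox value at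
  \<open>z = a - t * g $ i\<close>, the product \<open>(a - z) * (p - a)\<close> equals
  \<open>(z - p) * (a - p) - (p - a)\<^sup>2\<close>, and the first term is controlled by the
  subgradient inequality at \<open>p\<close>. Hence the rate is \<open>1 / t\<close>, not half of
  it.\<close>

lemma prox_l1_slope:
  fixes x v g :: "real^'n"
  assumes "t > 0" "\<mu> > 0" and v: "v = prox_l1 \<mu> t (x - t *\<^sub>R g) - x"
  shows "g \<bullet> v + \<mu> * l1_norm (x + v) - \<mu> * l1_norm x \<le> - (1 / t) * (norm v)\<^sup>2"
proof -
  have coord: "t * (g $ i * v $ i) + t * \<mu> * \<bar>x $ i + v $ i\<bar> - t * \<mu> * \<bar>x $ i\<bar> \<le> - (v $ i * v $ i)" for i
  proof -
    define a where "a = x $ i"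
    define z where "z = a - t * g $ i"
    define s where "s = t * \<mu>"
    define p where "p = max (\<bar>z\<bar> - s) 0 * sgn z"
    have s: "s > 0" using assms by (simp add: s_def)
    have vi: "v $ i = p - a" unfolding v p_def z_def a_def s_def by (simp add: prox_l1_def)
    \<comment> \<open>\<open>z - p\<close> is a subgradient of \<open>s\<close> times the absolute
      value at \<open>p\<close>; the cases are the zero, positive and negative branches of soft
      thresholding.\<close>
    have sub: "(z - p) * (a - p) \<le> s * (\<bar>a\<bar> - \<bar>p\<bar>)"
    proof (cases "\<bar>z\<bar> \<le> s")
      case True
      then have "p = 0" by (simp add: p_def)
      then show ?thesis using True abs_le_D1[of "z * a"] mult_right_mono[OF True, of "\<bar>a\<bar>"]
        by (simp add: abs_mult)
    next
      case False
      show ?thesis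
      proof (cases "z > 0")
        case True
        then have "p = z - s" "z - p = s" "p > 0" using False by (auto simp: p_def)
        then show ?thesis using s by (simp add: mult_left_mono)
      next
        case z: False
        then have zp: "z - p = - s" "p < 0" using False s by (auto simp: p_def sgn_if)
        have "(z - p) * (a - p) = s * (- a - \<bar>p\<bar>)"
          unfolding zp(1) using zp(2) by (simp add: algebra_simps)
        also have "\<dots> \<le> s * (\<bar>a\<bar> - \<bar>p\<bar>)" using s by (intro mult_left_mono) auto
        finally show ?thesis .
      qed
    qed
    have "t * g $ i = a - z" by (simp add: z_def)
    then have "t * (g $ i * v $ i) = (a - z) * (p - a)" by (simp add: vi mult.assoc[symmetric])
    moreover have "x $ i + v $ i = p" by (simp add: vi a_def)
    ultimately show ?thesis using sub unfolding s_def[symmetric] a_def[symmetric] vi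
      by (simp add: algebra_simps)
  qed
  have "(\<Sum>i\<in>UNIV. t * (g $ i * v $ i) + t * \<mu> * \<bar>x $ i + v $ i\<bar> - t * \<mu> * \<bar>x $ i\<bar>)
      \<le> (\<Sum>i\<in>UNIV. - (v $ i * v $ i))"
    by (rule sum_mono) (rule coord)
  then have "t * (g \<bullet> v + \<mu> * l1_norm (x + v) - \<mu> * l1_norm x) \<le> - (norm v)\<^sup>2"
    by (simp add: sum.distrib sum_subtractf sum_negf sum_distrib_left inner_vec_def l1_norm_def
        power2_norm_eq_inner algebra_simps)
  then have "(t * (g \<bullet> v + \<mu> * l1_norm (x + v) - \<mu> * l1_norm x)) / t \<le> (- (norm v)\<^sup>2) / t"
    using assms(1) by (intro divide_right_mono) auto
  then show ?thesis using assms(1) by simp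
qed

section \<open>Estimates for the \<open>l1_norm\<close>, gradients, and membership in tangent
  spaces\<close>

lemma l1_norm_triangle: "l1_norm (x + y) \<le> l1_norm x + l1_norm y"
  unfolding l1_norm_def sum.distrib[symmetric] by (intro sum_mono) (simp add: abs_triangle_ineq)

lemma l1_norm_scaleR: "l1_norm (c *\<^sub>R x) = \<bar>c\<bar> * l1_norm x"
  by (simp add: l1_norm_def abs_mult sum_distrib_left)

lemma l1_norm_le_card_norm: "l1_norm (x::real^'n) \<le> real CARD('n) * norm x"
  unfolding l1_norm_def
  using sum_mono[of UNIV "\<lambda>i. \<bar>x $ i\<bar>" "\<lambda>_. norm x", OF component_le_norm_cart] by simp


lemma restrict_rows_idem [simp]: "restrict_rows J (restrict_rows J u) = restrict_rows J u"
  by (simp add: restrict_rows_def vec_eq_iff)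

lemma transpose_restrict_rows_mult:
  "transpose (restrict_rows J A) *v u = transpose A *v restrict_rows J (u :: real^'n)"
  by (auto simp: restrict_rows_def matrix_vector_mult_def transpose_def vec_eq_iff intro!: sum.cong)

lemma GDERIV_gradient:
  assumes "f differentiable (at x)"
  shows "GDERIV f x :> gradient f x"
proof -
  obtain f' where f': "(f has_derivative f') (at x)"
    using assms differentiable_def by blast
  \<comment> \<open>The gradient is obtained as the adjoint of the derivative applied to 1.\<close>
  have "f' = (\<lambda>h. inner h (adjoint f' 1))"
    using adjoint_works[OF has_derivative_linear[OF f'], of _ 1] by auto
  then have "GDERIV f x :> adjoint f' 1"
    using f' by (simp add: gderiv_def)
  moreover have "g = g'" if "GDERIV f x :> g" "GDERIV f x :> g'" for g g'
    using has_derivative_unique[OF that[unfolded gderiv_def]] vector_eq_ldot by metis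
  ultimately have "\<exists>!g. GDERIV f x :> g" by blast
  then show ?thesis unfolding gradient_def by (rule theI')
qed

text \<open>The mean value theorem on the segment gives the constant \<open>L\<close> in place of
  the sharp \<open>L / 2\<close>; later estimates use only that some quadratic bound exists.\<close>

lemma lipschitz_gradient_upper_bound:
  fixes f :: "'a::euclidean_space \<Rightarrow> real"
  assumes diff: "\<And>z. f differentiable (at z)" and L: "L-lipschitz_on UNIV (gradient f)"
  shows "f y \<le> f x + gradient f x \<bullet> (y - x) + L * (norm (y - x))\<^sup>2"
proof -
  have D: "((\<lambda>s. f (x + s *\<^sub>R (y - x))) has_real_derivative gradient f (x + s *\<^sub>R (y - x)) \<bullet> (y - x)) (at s)" for s
  proof -
    have "((\<lambda>s. x + s *\<^sub>R (y - x)) has_derivative (\<lambda>h. h *\<^sub>R (y - x))) (at s)"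
      by (auto intro!: derivative_eq_intros)
    moreover have "(f has_derivative (\<lambda>h. h \<bullet> gradient f (x + s *\<^sub>R (y - x)))) (at (x + s *\<^sub>R (y - x)))"
      using GDERIV_gradient[OF diff] by (simp add: gderiv_def)
    ultimately have "((\<lambda>s. f (x + s *\<^sub>R (y - x))) has_derivative
        (\<lambda>h. (h *\<^sub>R (y - x)) \<bullet> gradient f (x + s *\<^sub>R (y - x)))) (at s)"
      by (rule has_derivative_compose)
    then show ?thesis
      by (simp add: has_field_derivative_def inner_commute mult.commute[of _ "_ \<bullet> _"] mult_commute_abs)
  qed
  obtain s where s: "0 < s" "s < 1"
      "f (x + 1 *\<^sub>R (y - x)) - f (x + 0 *\<^sub>R (y - x)) = (1 - 0) * (gradient f (x + s *\<^sub>R (y - x)) \<bullet> (y - x))"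
    using MVT2[of 0 1, OF _ D] by auto
  have "(gradient f (x + s *\<^sub>R (y - x)) - gradient f x) \<bullet> (y - x)
      \<le> norm (gradient f (x + s *\<^sub>R (y - x)) - gradient f x) * norm (y - x)"
    by (rule norm_cauchy_schwarz)
  also have "\<dots> \<le> (L * norm (s *\<^sub>R (y - x))) * norm (y - x)"
    using lipschitz_onD[OF L, of "x + s *\<^sub>R (y - x)" x]
    by (intro mult_right_mono) (auto simp: dist_norm)
  also have "\<dots> \<le> (L * norm (y - x)) * norm (y - x)"
    using s lipschitz_on_nonneg[OF L]
    by (intro mult_right_mono mult_left_mono) (auto simp: mult_left_le_one_le)
  finally show ?thesis
    using s(3) by (simp add: inner_diff_left power2_eq_square mult.assoc)
qed

text \<open>\<open>w\<close> is orthogonal to the spanning columns, hence to the normal space, and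
  the double orthogonal complement of a subspace is the subspace itself.\<close>

lemma mem_of_transpose_basis_eq_0:
  assumes "orthonormal_normal_basis M y C" "subspace (tangent_space M y)" "transpose C *v w = 0"
  shows "w \<in> tangent_space M y"
proof -
  have "orthogonal w z" if z: "z \<in> columns C" for z
  proof -
    obtain j where "z = column j C" using z by (auto simp: columns_def)
    then have "z \<bullet> w = (transpose C *v w) $ j"
      by (simp add: matrix_vector_mult_def transpose_def column_def inner_vec_def)
    then show ?thesis using assms(3) by (simp add: orthogonal_def inner_commute)
  qed
  then have "\<forall>z\<in>span (columns C). orthogonal w z"
    using orthogonal_to_span by blast
  then have "w \<in> orthogonal_comp (normal_space M y)"
    using assms(1) by (auto simp: orthonormal_normal_basis_def orthogonal_comp_def orthogonal_commute)
  then show ?thesis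
    unfolding normal_space_def using orthogonal_comp_self[OF assms(2)] by simp
qed

lemma inner_mult_transpose_eq_0:
  fixes C :: "real^'c^'n"
  assumes "transpose C *v v = 0"
  shows "(C *v l) \<bullet> v = 0"
proof -
  have "v v* C = 0" using assms by simp
  then show ?thesis using dot_lmul_matrix[of v C l] by (simp add: inner_commute)
qed

section \<open>Descent along the search directions\<close>

locale rpn_cg_setting =
  rpn_cg M R f \<mu> B lam vartheta \<gamma> \<tau> \<theta> \<kappa> \<alpha>init \<rho>1 \<rho>2 tmin tmax \<omega>1 \<omega>2
  for M :: "(real^'n) set"
    and R :: "real^'n \<Rightarrow> real^'n \<Rightarrow> real^'n"
    and f :: "real^'n \<Rightarrow> real"
    and \<mu> :: real
    and B :: "real^'n \<Rightarrow> real^'c^'n"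
    and lam :: "real \<Rightarrow> real^'n \<Rightarrow> real^'c"
    and vartheta \<gamma> \<tau> \<theta> \<kappa> :: real
    and \<alpha>init \<rho>1 \<rho>2 tmin tmax \<omega>1 \<omega>2 :: real +
  assumes compact: "compact M"
    and subspace_tangent: "y \<in> M \<Longrightarrow> subspace (tangent_space M y)"
    and retraction: "riem_retraction M R"
    and f_differentiable: "f differentiable (at z)"
    and lipschitz_gradient: "\<exists>L. L-lipschitz_on UNIV (gradient f)"
    and \<mu>_pos: "\<mu> > 0"
    and basis: "y \<in> M \<Longrightarrow> orthonormal_normal_basis M y (B y)"
    and multiplier: "s > 0 \<Longrightarrow> y \<in> M \<Longrightarrow> lagrange_multiplier s y (lam s y)"
    and \<gamma>_pos: "\<gamma> > 0"
    and \<alpha>init_pos: "\<alpha>init > 0" and \<rho>1_pos: "0 < \<rho>1" and \<rho>2: "0 < \<rho>2" "\<rho>2 < 1"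
    and tmin_pos: "0 < tmin" and tmin_le_tmax: "tmin \<le> tmax"
    and \<omega>1: "\<omega>1 > 1" and \<omega>2: "0 < \<omega>2" "\<omega>2 < 1"
    and \<rho>1_less: "\<rho>1 < \<gamma> / 2" "\<rho>1 < 1 / tmax"
begin

text \<open>By convexity of \<open>h\<close> this bounds the directional derivative of
  \<open>F\<close> at \<open>y\<close> along \<open>d\<close> from above.\<close>

definition slope :: "real^'n \<Rightarrow> real^'n \<Rightarrow> real" where
  "slope y d = gradient f y \<bullet> d + h (y + d) - h y"

text \<open>\<open>\<gamma> / 2\<close> is the rate of directions that pass the tCG tests, and
  \<open>1 / tmax\<close> is the worst rate of the proximal directions.\<close>

definition slope_rate :: real where
  "slope_rate = min (\<gamma> / 2) (1 / tmax)"

text \<open>The padded copy of the subspace in which all tCG iterates live: corrections supported on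
  \<open>supp s y\<close> that keep the stacked direction tangent.\<close>

definition tangent_support :: "real \<Rightarrow> real^'n \<Rightarrow> (real^'n) set" where
  "tangent_support s y = {w. bar s y w = w \<and> transpose (B y) *v w = 0}"

definition passes_tests :: "real \<Rightarrow> real^'n \<Rightarrow> real^'n \<Rightarrow> bool" where
  "passes_tests s y d \<longleftrightarrow> \<not> (curv_too_small s y d \<or> G s y d > G s y 0)"

section \<open>Truncated CG stays in \<open>tangent_support\<close>\<close>

lemma subspace_tangent_support: "subspace (tangent_support s y)"
proof -
  have "subspace {w::real^'n. bar s y w = w}"
    by (auto simp: subspace_def restrict_rows_def vec_eq_iff)
  moreover have "subspace {w. transpose (B y) *v w = 0}"
    by (auto simp: subspace_def matrix_vector_right_distrib matrix_vector_mult_scaleR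
        simp del: transpose_matrix_vector)
  ultimately show ?thesis
    unfolding tangent_support_def Collect_conj_eq by (rule subspace_inter)
qed

lemma stack_eq: "stack s y w = pg_dir s y + w"
  by (auto simp: stack_def restrict_rows_def vec_eq_iff)

text \<open>On vectors supported on \<open>supp s y\<close> the transpose of \<open>B y\<close> acts
  like that of its upper block, and that block annihilates the range of \<open>P_op\<close> by
  \<open>transpose_mult_pinv\<close>.\<close>

lemma P_op_in_tangent_support: "P_op s y u \<in> tangent_support s y"
proof -
  let ?J = "supp s y"
  have bar: "bar s y (P_op s y u) = P_op s y u"
    by (auto simp: P_op_def vec_eq_iff restrict_rows_def matrix_vector_mult_def matrix_matrix_mult_def)
  have "transpose (B y) *v P_op s y u = transpose (bar s y (B y)) *v P_op s y u"
    by (simp only: transpose_restrict_rows_mult bar)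
  also have "\<dots> = transpose (bar s y (B y)) *v bar s y u
      - (transpose (bar s y (B y)) ** (bar s y (B y) ** pinv (bar s y (B y)))) *v u"
    by (simp only: P_op_def matrix_vector_mult_diff_distrib matrix_vector_mul_assoc)
  also have "\<dots> = 0"
    by (simp only: transpose_mult_pinv transpose_restrict_rows_mult restrict_rows_idem diff_self)
  finally show ?thesis using bar by (simp add: tangent_support_def)
qed

text \<open>Each \<open>q\<close> is a value of \<open>P_op\<close>, so residuals, directions and
  iterates never leave the subspace. The exits \<open>NegCurv\<close> and \<open>Early3\<close>
  return the old iterate, which is either the initial 0 or was tested in the previous pass; hence
  the disjunction is carried along.\<close>

lemma tcg_loop_invariant:
  assumes "tcg_loop s y r0 w r p \<delta> w' st"
    and "w \<in> tangent_support s y" "r \<in> tangent_support s y" "p \<in> tangent_support s y"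
    and "w = 0 \<or> passes_tests s y (stack s y w)"
  shows "w' \<in> tangent_support s y \<and> (w' = 0 \<or> passes_tests s y (stack s y w'))"
  using assms
proof (induction rule: tcg_loop.induct)
  case (converged q p \<delta> \<alpha> r w1 w r1 d1)
  then show ?case
    using subspace_tangent_support[of s y]
    by (auto simp: passes_tests_def intro!: subspace_add subspace_scale)
next
  case (continue q p \<delta> \<alpha> r w1 w r1 d1 \<beta> p1 \<delta>1 w' st)
  note sub = subspace_tangent_support[of s y]
  have "w1 \<in> tangent_support s y" "r1 \<in> tangent_support s y"
    using continue.hyps continue.prems P_op_in_tangent_support
    by (auto intro!: subspace_add[OF sub] subspace_scale[OF sub])
  moreover from this have "p1 \<in> tangent_support s y"
    unfolding \<open>p1 = - r1 + \<beta> *\<^sub>R p\<close>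
    using continue.prems(3) by (intro subspace_add[OF sub] subspace_neg[OF sub] subspace_scale[OF sub])
  moreover have "passes_tests s y (stack s y w1)"
    using continue.hyps by (auto simp: passes_tests_def)
  ultimately show ?case using continue.IH by blast
qed auto

section \<open>Tangency and slope of the search directions\<close>

lemma pg_dir_normal: "s > 0 \<Longrightarrow> y \<in> M \<Longrightarrow> transpose (B y) *v pg_dir s y = 0"
  using multiplier unfolding lagrange_multiplier_def by blast

text \<open>The prox inequality holds with \<open>gradient f y + B y *v lam s y\<close> as the
  linear term; the multiplier part is normal and vanishes against the tangent
  \<open>pg_dir s y\<close>.\<close>

lemma slope_pg_dir:
  assumes "s > 0" "y \<in> M"
  shows "slope y (pg_dir s y) \<le> - (1 / s) * (norm (pg_dir s y))\<^sup>2"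
proof -
  have "pg_dir s y = prox_l1 \<mu> s (y - s *\<^sub>R (gradient f y + B y *v lam s y)) - y"
    using multiplier[OF assms] unfolding lagrange_multiplier_def by blast
  from prox_l1_slope[OF assms(1) \<mu>_pos this]
  show ?thesis
    using inner_mult_transpose_eq_0[OF pg_dir_normal[OF assms], of "lam s y"]
    by (simp add: slope_def h_def inner_add_left)
qed

text \<open>The descent test bounds the slope by minus half of a quadratic form, and the curvature
  test bounds the same form from below, so no bound on the Hessian or the Weingarten map is
  required. The assumption on \<open>hat\<close> matches the two \<open>\<tau>\<close> terms, one
  written with \<open>d\<close> and the other with \<open>pg_dir s y\<close>.\<close>

lemma slope_passes_tests:
  assumes "passes_tests s y d" "hat s y d = hat s y (pg_dir s y)"
  shows "slope y d \<le> - (\<gamma> / 2) * (norm d)\<^sup>2"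
proof -
  have "hat s y (0::real^'n) = 0" by (simp add: restrict_rows_def vec_eq_iff)
  then have "G s y 0 = f y + h y" by (simp add: G_def)
  then have "G s y d \<le> f y + h y" using assms(1) by (simp add: passes_tests_def)
  then have "slope y d \<le> - (1 / 2) * (d \<bullet> B_op s y d + \<tau> * (norm (hat s y d))\<^sup>2)"
    by (simp add: G_def slope_def field_simps)
  moreover have "d \<bullet> B_op s y d + \<tau> * (norm (hat s y d))\<^sup>2 \<ge> \<gamma> * (norm d)\<^sup>2"
    using assms by (simp add: passes_tests_def curv_too_small_def)
  ultimately show ?thesis by (simp add: field_simps)
qed

lemma search_dir_descent:
  assumes "search_dir s y d st" "y \<in> M" "0 < s" "s \<le> tmax"
  shows "d \<in> tangent_space M y" "slope y d \<le> - slope_rate * (norm d)\<^sup>2"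
proof -
  obtain w where w: "tcg s y w st" "d = stack s y w"
    using assms(1) by (auto simp: search_dir_def)
  note sub = subspace_tangent_support[of s y]
  have inv: "w \<in> tangent_support s y \<and> (w = 0 \<or> passes_tests s y (stack s y w))"
  proof -
    have "w = 0 \<or> tcg_loop s y (P_op s y (ell s y)) 0 (P_op s y (ell s y)) (- P_op s y (ell s y))
        (P_op s y (ell s y) \<bullet> P_op s y (ell s y)) w st"
      using w(1) by (auto simp: tcg_def Let_def split: if_splits)
    then show ?thesis
      using tcg_loop_invariant P_op_in_tangent_support subspace_0[OF sub] subspace_neg[OF sub] by blast
  qed
  have "transpose (B y) *v d = 0"
    using inv pg_dir_normal[OF assms(3,2)]
    by (simp add: w(2) stack_eq tangent_support_def matrix_vector_right_distrib)
  then show "d \<in> tangent_space M y"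
    using mem_of_transpose_basis_eq_0 basis subspace_tangent assms(2) by blast
  have rate: "slope_rate \<le> c \<Longrightarrow> slope y d \<le> - c * (norm d)\<^sup>2 \<Longrightarrow> slope y d \<le> - slope_rate * (norm d)\<^sup>2" for c
    using mult_right_mono[of slope_rate c "(norm d)\<^sup>2"] by simp
  show "slope y d \<le> - slope_rate * (norm d)\<^sup>2"
  proof (cases "w = 0")
    \<comment> \<open>This covers both early exits before CG as well as a loop that returns its
      starting value; then \<open>d\<close> is the proximal direction.\<close>
    case True
    show ?thesis
    proof (rule rate)
      show "slope_rate \<le> 1 / s"
        using assms(3,4) by (auto simp: slope_rate_def min_le_iff_disj intro!: disjI2 divide_left_mono)
      show "slope y d \<le> - (1 / s) * (norm d)\<^sup>2"
        using slope_pg_dir[OF assms(3,2)] True by (simp add: w(2) stack_eq)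
    qed
  next
    case False
    \<comment> \<open>A correction supported on \<open>supp s y\<close> leaves the complementary
      block of \<open>d\<close> equal to that of \<open>pg_dir s y\<close>.\<close>
    have "bar s y w = w" using inv by (simp add: tangent_support_def)
    then have "hat s y w = hat s y (bar s y w)" by simp
    also have "\<dots> = 0" by (simp add: restrict_rows_def vec_eq_iff)
    finally have "hat s y w = 0" .
    moreover have "hat s y d = hat s y (pg_dir s y) + hat s y w"
      by (auto simp: w(2) stack_eq restrict_rows_def vec_eq_iff)
    ultimately have "hat s y d = hat s y (pg_dir s y)" by simp
    then have "slope y d \<le> - (\<gamma> / 2) * (norm d)\<^sup>2"
      using inv False w(2) by (intro slope_passes_tests) auto
    then show ?thesis by (rule rate[rotated]) (simp add: slope_rate_def)
  qed
qed

lemma retraction_search_dir_in_M: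
  assumes "search_dir s y d st" "y \<in> M" "0 < s" "s \<le> tmax"
  shows "R y (\<alpha> *\<^sub>R d) \<in> M"
  using search_dir_descent(1)[OF assms] subspace_scale[OF subspace_tangent[OF assms(2)]] retraction assms(2)
  by (auto simp: riem_retraction_def tangent_bundle_def)

lemma next_t_bounds:
  assumes "tmin \<le> s" "s \<le> tmax"
  shows "tmin \<le> next_t s y d st" "next_t s y d st \<le> tmax"
proof -
  have "\<omega>2 * s \<le> s" using assms tmin_pos \<omega>2 by (intro mult_left_le_one_le) auto
  moreover have "1 * s \<le> \<omega>1 * s" using assms tmin_pos \<omega>1 by (intro mult_right_mono) auto
  ultimately show "tmin \<le> next_t s y d st" "next_t s y d st \<le> tmax"
    using assms tmin_le_tmax by (auto simp: next_t_def)
qed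

section \<open>Uniform step sizes for backtracking\<close>

lemma h_triangle: "h (y + u) \<le> h y + h u"
  using l1_norm_triangle[of y u] \<mu>_pos by (simp add: h_def distrib_left[symmetric])

lemma h_convex_step:
  assumes "0 \<le> \<alpha>" "\<alpha> \<le> 1"
  shows "h (y + \<alpha> *\<^sub>R d) \<le> h y + \<alpha> * (h (y + d) - h y)"
proof -
  have "y + \<alpha> *\<^sub>R d = (1 - \<alpha>) *\<^sub>R y + \<alpha> *\<^sub>R (y + d)" by (simp add: algebra_simps)
  then have "h (y + \<alpha> *\<^sub>R d) \<le> h ((1 - \<alpha>) *\<^sub>R y) + h (\<alpha> *\<^sub>R (y + d))"
    using h_triangle by metis
  also have "\<dots> = (1 - \<alpha>) * h y + \<alpha> * h (y + d)"
    using assms by (simp add: h_def l1_norm_scaleR)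
  finally show ?thesis by (simp add: algebra_simps)
qed

text \<open>The retraction error is moved into the quadratic term, so that \<open>h\<close> is
  evaluated on the straight line \<open>y + u\<close>, where convexity can be used.\<close>

lemma F_retraction_bound:
  "\<exists>E\<ge>0. \<forall>y\<in>M. \<forall>u\<in>tangent_space M y.
     F (R y u) \<le> f y + gradient f y \<bullet> u + h (y + u) + E * (norm u)\<^sup>2"
proof -
  obtain K where K: "K \<ge> 0" "\<And>y u. y \<in> M \<Longrightarrow> u \<in> tangent_space M y \<Longrightarrow>
      norm (R y u - y - u) \<le> K * (norm u)\<^sup>2"
    using retraction_second_order[OF retraction subspace_tangent compact] by blast
  obtain L where L: "L-lipschitz_on UNIV (gradient f)" using lipschitz_gradient by blast
  have "continuous_on M (gradient f)"
    using lipschitz_on_continuous_on[OF L] continuous_on_subset by blast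
  then have "bounded (gradient f ` M)"
    using compact compact_continuous_image compact_imp_bounded by blast
  then obtain g where g: "\<And>y. y \<in> M \<Longrightarrow> norm (gradient f y) \<le> g"
    by (auto simp: bounded_iff)
  obtain b where b: "\<And>y. y \<in> M \<Longrightarrow> norm y \<le> b"
    using compact_imp_bounded[OF compact] by (auto simp: bounded_iff)
  \<comment> \<open>\<open>1 + K\<close> serves for \<open>norm u \<le> 1\<close>, and
    \<open>2 * \<bar>b\<bar>\<close>, a bound on the diameter of \<open>M\<close>, for longer
    vectors.\<close>
  define C where "C = 1 + K + 2 * \<bar>b\<bar>"
  \<comment> \<open>The summands bound, in this order, the gradient against the retraction error
    \<open>e\<close>, the quadratic remainder of \<open>f\<close>, and \<open>h e\<close>.\<close>
  define E where "E = \<bar>g\<bar> * K + L * C\<^sup>2 + \<mu> * real CARD('n) * K"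
  have E: "E \<ge> 0"
    using K(1) lipschitz_on_nonneg[OF L] \<mu>_pos by (simp add: E_def)
  have "F (R y u) \<le> f y + gradient f y \<bullet> u + h (y + u) + E * (norm u)\<^sup>2"
    if y: "y \<in> M" and u: "u \<in> tangent_space M y" for y u
  proof -
    define z where "z = R y u"
    define e where "e = z - y - u"
    have z: "z = y + u + e" by (simp add: e_def)
    have zM: "z \<in> M"
      using retraction y u by (auto simp: z_def riem_retraction_def tangent_bundle_def)
    have e: "norm e \<le> K * (norm u)\<^sup>2" using K(2)[OF y u] by (simp add: e_def z_def)
    have zy: "norm (z - y) \<le> C * norm u"
    proof (cases "norm u \<le> 1")
      case True
      have "norm (z - y) \<le> norm u + norm e" using norm_triangle_ineq[of u e] by (simp add: z)
      also have "norm e \<le> K * norm u"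
        using e True K(1) by (rule_tac order_trans[OF e]) (auto simp: power2_eq_square intro!: mult_left_mono mult_left_le_one_le)
      also have "norm u + K * norm u \<le> C * norm u"
        by (simp add: C_def algebra_simps)
      finally show ?thesis by simp
    next
      case False
      have "norm (z - y) \<le> 2 * \<bar>b\<bar>"
        using b[OF zM] b[OF y] norm_triangle_ineq4[of z y] by linarith
      also have "\<dots> \<le> C * 1" using K(1) by (simp add: C_def)
      also have "\<dots> \<le> C * norm u" using False K(1) by (intro mult_left_mono) (auto simp: C_def)
      finally show ?thesis .
    qed
    have "f z \<le> f y + gradient f y \<bullet> (z - y) + L * (norm (z - y))\<^sup>2"
      by (rule lipschitz_gradient_upper_bound[OF f_differentiable L])
    also have "(norm (z - y))\<^sup>2 \<le> (C * norm u)\<^sup>2"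
      using zy by (intro power_mono) auto
    also have "gradient f y \<bullet> (z - y) = gradient f y \<bullet> u + gradient f y \<bullet> e"
      by (simp add: z inner_add_right)
    also have "gradient f y \<bullet> e \<le> \<bar>g\<bar> * (K * (norm u)\<^sup>2)"
    proof -
      have "gradient f y \<bullet> e \<le> norm (gradient f y) * norm e" by (rule norm_cauchy_schwarz)
      also have "\<dots> \<le> \<bar>g\<bar> * (K * (norm u)\<^sup>2)"
        using e g[OF y] by (intro mult_mono) auto
      finally show ?thesis .
    qed
    finally have fz: "f z \<le> f y + gradient f y \<bullet> u + \<bar>g\<bar> * (K * (norm u)\<^sup>2) + L * (C * norm u)\<^sup>2"
      using lipschitz_on_nonneg[OF L] by (simp add: mult_left_mono)
    have "h z \<le> h (y + u) + h e" unfolding z by (rule h_triangle)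
    also have "h e \<le> \<mu> * (real CARD('n) * (K * (norm u)\<^sup>2))"
      unfolding h_def using \<mu>_pos e l1_norm_le_card_norm[of e]
      by (intro mult_left_mono order_trans[OF l1_norm_le_card_norm]) auto
    finally show ?thesis using fz
      by (simp add: F_def z_def[symmetric] E_def power_mult_distrib algebra_simps)
  qed
  then show ?thesis using E by blast
qed

lemma uniform_sufficient_decrease:
  "\<exists>a>0. \<forall>y\<in>M. \<forall>d\<in>tangent_space M y. \<forall>\<alpha>. slope y d \<le> - slope_rate * (norm d)\<^sup>2 \<longrightarrow>
     0 < \<alpha> \<longrightarrow> \<alpha> \<le> a \<longrightarrow> \<not> insufficient_decrease y d \<alpha>"
proof -
  obtain E where E: "E \<ge> 0" "\<And>y u. y \<in> M \<Longrightarrow> u \<in> tangent_space M y \<Longrightarrow>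
      F (R y u) \<le> f y + gradient f y \<bullet> u + h (y + u) + E * (norm u)\<^sup>2"
    using F_retraction_bound by blast
  have rate: "\<rho>1 < slope_rate" using \<rho>1_less by (simp add: slope_rate_def)
  \<comment> \<open>The bound 1 permits the convexity estimate for \<open>h\<close>; the quotient
    makes the quadratic error fit into the gap \<open>slope_rate - \<rho>1\<close>.\<close>
  define a where "a = min 1 ((slope_rate - \<rho>1) / (E + 1))"
  have a: "a > 0" using rate E(1) by (simp add: a_def)
  have "\<not> insufficient_decrease y d \<alpha>"
    if y: "y \<in> M" and d: "d \<in> tangent_space M y" and sl: "slope y d \<le> - slope_rate * (norm d)\<^sup>2"
      and \<alpha>: "0 < \<alpha>" "\<alpha> \<le> a" for y d \<alpha>
  proof -
    have "E * \<alpha> \<le> (E + 1) * \<alpha>" using \<alpha>(1) by simp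
    also have "\<dots> \<le> (E + 1) * ((slope_rate - \<rho>1) / (E + 1))"
      using \<alpha>(2) E(1) by (intro mult_left_mono) (auto simp: a_def)
    also have "\<dots> = slope_rate - \<rho>1" using E(1) by simp
    finally have E\<alpha>: "E * \<alpha> \<le> slope_rate - \<rho>1" .
    have "F (R y (\<alpha> *\<^sub>R d)) \<le> f y + gradient f y \<bullet> (\<alpha> *\<^sub>R d) + h (y + \<alpha> *\<^sub>R d) + E * (norm (\<alpha> *\<^sub>R d))\<^sup>2"
      using E(2)[OF y] subspace_scale[OF subspace_tangent[OF y] d] by blast
    also have "h (y + \<alpha> *\<^sub>R d) \<le> h y + \<alpha> * (h (y + d) - h y)"
      using \<alpha> by (intro h_convex_step) (auto simp: a_def)
    finally have "F (R y (\<alpha> *\<^sub>R d)) \<le> F y + \<alpha> * slope y d + \<alpha> * (E * \<alpha>) * (norm d)\<^sup>2"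
      by (simp add: F_def slope_def power_mult_distrib power2_eq_square algebra_simps)
    also have "\<alpha> * slope y d \<le> \<alpha> * (- slope_rate * (norm d)\<^sup>2)"
      using sl \<alpha>(1) by (intro mult_left_mono) auto
    also have "\<alpha> * (E * \<alpha>) * (norm d)\<^sup>2 \<le> \<alpha> * (slope_rate - \<rho>1) * (norm d)\<^sup>2"
      using E\<alpha> \<alpha>(1) by (intro mult_right_mono mult_left_mono) auto
    finally have "F (R y (\<alpha> *\<^sub>R d)) \<le> F y - \<alpha> * \<rho>1 * (norm d)\<^sup>2"
      by (simp add: algebra_simps)
    then show ?thesis by (simp add: insufficient_decrease_def)
  qed
  then show ?thesis using a by blast
qed

text \<open>Either the first trial is accepted, or the previous trial, larger by the factor
  \<open>1 / \<rho>2\<close>, was rejected and therefore exceeds the uniform threshold. In both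
  cases the accepted step size is bounded below.\<close>

lemma backtracking_step_decrease:
  "\<exists>a>0. \<forall>y\<in>M. \<forall>s d st \<alpha>. 0 < s \<longrightarrow> s \<le> tmax \<longrightarrow> search_dir s y d st \<longrightarrow> backtracking_step y d \<alpha> \<longrightarrow>
     F (R y (\<alpha> *\<^sub>R d)) \<le> F y - a * (norm d)\<^sup>2"
proof -
  obtain a where a: "a > 0" "\<And>y d \<alpha>. y \<in> M \<Longrightarrow> d \<in> tangent_space M y \<Longrightarrow>
      slope y d \<le> - slope_rate * (norm d)\<^sup>2 \<Longrightarrow> 0 < \<alpha> \<Longrightarrow> \<alpha> \<le> a \<Longrightarrow> \<not> insufficient_decrease y d \<alpha>"
    using uniform_sufficient_decrease by blast
  define a' where "a' = min \<alpha>init (\<rho>2 * a)"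
  have a': "a' > 0" using a(1) \<alpha>init_pos \<rho>2 by (simp add: a'_def)
  have "F (R y (\<alpha> *\<^sub>R d)) \<le> F y - (a' * \<rho>1) * (norm d)\<^sup>2"
    if y: "y \<in> M" and s: "0 < s" "s \<le> tmax" and d: "search_dir s y d st" and bt: "backtracking_step y d \<alpha>"
    for y s d st \<alpha>
  proof -
    obtain m where m: "\<alpha> = \<rho>2 ^ m * \<alpha>init" "\<not> insufficient_decrease y d \<alpha>"
        "\<And>i. i < m \<Longrightarrow> insufficient_decrease y d (\<rho>2 ^ i * \<alpha>init)"
      using bt unfolding backtracking_step_def by blast
    have "a' \<le> \<alpha>"
    proof (cases m)
      case 0
      then show ?thesis by (simp add: m(1) a'_def)
    next
      case (Suc i)
      have "\<not> \<rho>2 ^ i * \<alpha>init \<le> a"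
        using a(2)[OF y search_dir_descent[OF d y s], of "\<rho>2 ^ i * \<alpha>init"] m(3)[of i] Suc \<rho>2 \<alpha>init_pos
        by auto
      then have "\<rho>2 * a \<le> \<rho>2 * (\<rho>2 ^ i * \<alpha>init)" using \<rho>2 by simp
      then show ?thesis by (simp add: m(1) a'_def Suc mult.assoc)
    qed
    then have "a' * \<rho>1 * (norm d)\<^sup>2 \<le> \<alpha> * \<rho>1 * (norm d)\<^sup>2"
      using \<rho>1_pos by (intro mult_right_mono) auto
    then show ?thesis using m(2) by (simp add: insufficient_decrease_def)
  qed
  moreover have "a' * \<rho>1 > 0" using a' \<rho>1_pos by simp
  ultimately show ?thesis by blast
qed

end

section \<open>Rounds of the main loop\<close>

context rpn_cg
begin

text \<open>
  The case \<open>safeguarded\<close> also covers a tentative step followed by a rejection: \<open>x\<^bsub>k+1\<^esub>\<close> is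
  then overwritten by the backtracking step from \<open>x\<^sub>k\<close>, while \<open>t\<^bsub>k+1\<^esub>\<close> is kept.
\<close>

inductive rpn_round :: "nat \<Rightarrow> real^'n \<Rightarrow> real \<Rightarrow> nat \<Rightarrow> real^'n \<Rightarrow> real \<Rightarrow> bool" for k y s where
  safeguarded:
    "\<lbrakk> search_dir s y d st; backtracking_step y d \<alpha> \<rbrakk>
     \<Longrightarrow> rpn_round k y s (Suc k) (R y (\<alpha> *\<^sub>R d)) (next_t s y d st)"
| accepted:
    "\<lbrakk> search_dir s y d st; y' = R y d; s' = next_t s y d st; search_dir s' y' d' st';
       F (R y' d') \<le> F y - \<rho>1 * (norm (pg_dir s y))\<^sup>2 \<rbrakk>
     \<Longrightarrow> rpn_round k y s (Suc (Suc k)) (R y' d') (next_t s' y' d' st')"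

text \<open>From flag 0 only \<open>line_search\<close> or \<open>tentative\<close> can fire; the
  latter sets the flag to 1, after which only \<open>accept\<close> or \<open>reject\<close> can
  fire, and both reset it. On \<open>reject\<close> the stored direction at the previous index is
  the tentative one, and the pass writes only a later entry of \<open>ts\<close>, so the step size
  from the tentative pass survives. The clause on earlier entries serves to identify final
  contents.\<close>

lemma round_of_steps:
  assumes "rpn_step S S'" "rpn_step S' S''" "flag S = 0"
  shows "\<exists>Z\<in>{S', S''}. flag Z = 0 \<and>
    rpn_round (iter S) (xs S (iter S)) (ts S (iter S)) (iter Z) (xs Z (iter Z)) (ts Z (iter Z)) \<and>
    (\<forall>j\<le>iter S. xs Z j = xs S j \<and> ts Z j = ts S j)"
  using assms(1)
proof cases
  case (line_search t k x dk st t' d' d fl \<alpha>)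
  then show ?thesis by (intro bexI[of _ S']) (auto intro: safeguarded)
next
  case (tentative t k x dk st t' d' d fl)
  note S' = \<open>S' = _\<close>
  show ?thesis
    using assms(2)
  proof cases
    case (line_search t2 k2 x2 dk2 st2 t2' d2' d2 fl2 \<alpha>)
    then show ?thesis using tentative by simp
  next
    case (tentative t2 k2 x2 dk2 st2 t2' d2' d2 fl2)
    then show ?thesis using S' by simp
  next
    case (accept t2 k2 x2 dk2 st2 t2' d2' d2 fl2)
    have "rpn_round k (x k) (t k) (Suc (Suc k)) (R (R (x k) dk) dk2)
        (next_t (next_t (t k) (x k) dk st) (R (x k) dk) dk2 st2)"
      by (rule accepted[OF tentative(3) refl refl]) (use accept tentative in auto)
    then show ?thesis using accept tentative by (intro bexI[of _ S'']) auto
  next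
    case (reject t2 k2 x2 dk2 st2 t2' d2' d2 fl2 \<alpha>)
    have "rpn_round k (x k) (t k) (Suc k) (R (x k) (\<alpha> *\<^sub>R dk)) (next_t (t k) (x k) dk st)"
      by (rule safeguarded[OF tentative(3)]) (use reject tentative in auto)
    then show ?thesis using reject tentative by (intro bexI[of _ S'']) auto
  qed
qed (use assms(3) in auto)

lemma round_gt: "rpn_round k y s k' y' s' \<Longrightarrow> k < k'"
  by (auto elim: rpn_round.cases)

text \<open>The sequences are limits of memory contents that may be overwritten. Entries up to the
  counter are safe whenever the flag is 0, so at these states the contents are already final, and
  consecutive such states are joined by a round.\<close>

lemma generates_rounds:
  assumes "generates x0 t0 x t"
  shows "\<exists>k. k 0 = 0 \<and> x 0 = x0 \<and> t 0 = t0 \<and>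
    (\<forall>i. rpn_round (k i) (x (k i)) (t (k i)) (k (Suc i)) (x (k (Suc i))) (t (k (Suc i))))"
proof -
  obtain S where S: "iter (S 0) = 0" "flag (S 0) = 0" "xs (S 0) 0 = x0" "ts (S 0) 0 = t0"
      "\<And>m. rpn_step (S m) (S (Suc m))"
      "\<And>k. \<forall>\<^sub>F m in sequentially. xs (S m) k = x k \<and> ts (S m) k = t k"
    using assms unfolding generates_def by blast
  \<comment> \<open>The clause for \<open>i = 0\<close> anchors the chosen subsequence of states at
    the initial state.\<close>
  let ?P = "\<lambda>i m. flag (S m) = 0 \<and> (i = (0::nat) \<longrightarrow> m = 0)"
  let ?Q = "\<lambda>m m'. m < m' \<and>
      rpn_round (iter (S m)) (xs (S m) (iter (S m))) (ts (S m) (iter (S m)))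
        (iter (S m')) (xs (S m') (iter (S m'))) (ts (S m') (iter (S m'))) \<and>
      (\<forall>j\<le>iter (S m). xs (S m') j = xs (S m) j \<and> ts (S m') j = ts (S m) j)"
  have "\<exists>n. \<forall>i. ?P i (n i) \<and> ?Q (n i) (n (Suc i))"
  proof (rule dependent_nat_choice)
    show "\<exists>m. ?P 0 m" using S(2) by blast
  next
    fix m i assume "?P i m"
    then have "flag (S m) = 0" by blast
    from round_of_steps[OF S(5) S(5) this]
    show "\<exists>m'. ?P (Suc i) m' \<and> ?Q m m'"
      using lessI[of m] less_SucI[OF lessI[of m]] by (auto 0 3)
  qed
  then obtain n where n: "n 0 = 0" "\<And>i. ?Q (n i) (n (Suc i))" by blast
  define k where "k i = iter (S (n i))" for i
  have "strict_mono k"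
    unfolding strict_mono_Suc_iff k_def using n(2) round_gt by blast
  then have k_mono: "k i \<le> k i'" if "i \<le> i'" for i i'
    using that strict_mono_less_eq by blast
  have stable: "xs (S (n i')) j = xs (S (n i)) j \<and> ts (S (n i')) j = ts (S (n i)) j"
    if "i \<le> i'" "j \<le> k i" for i i' j
    using that(1)
  proof (induction i' rule: dec_induct)
    case (step i')
    have "j \<le> iter (S (n i'))" using that(2) k_mono[OF step.hyps(1)] by (simp add: k_def)
    then show ?case using n(2)[of i'] step.IH by simp
  qed simp
  have n_ge: "i \<le> n i" for i
    using n(2) by (intro seq_suble) (auto simp: strict_mono_Suc_iff)
  \<comment> \<open>A sufficiently late round boundary shows the eventual value, and
    \<open>stable\<close> carries it back to boundary \<open>i\<close>.\<close>
  have final: "xs (S (n i)) (k i) = x (k i) \<and> ts (S (n i)) (k i) = t (k i)" for i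
  proof -
    obtain N where N: "\<And>m. m \<ge> N \<Longrightarrow> xs (S m) (k i) = x (k i) \<and> ts (S m) (k i) = t (k i)"
      using S(6)[of "k i"] unfolding eventually_sequentially by blast
    have "n (max i N) \<ge> N" using n_ge[of "max i N"] by simp
    then show ?thesis using N stable[of i "max i N" "k i"] by simp
  qed
  have "k 0 = 0" by (simp add: k_def n(1) S(1))
  moreover have "x 0 = x0" "t 0 = t0"
    using final[of 0] S(3,4) \<open>k 0 = 0\<close> by (simp_all add: n(1))
  moreover have "rpn_round (k i) (x (k i)) (t (k i)) (k (Suc i)) (x (k (Suc i))) (t (k (Suc i)))" for i
    using n(2)[of i] final[of i] final[of "Suc i"] by (simp add: k_def)
  ultimately show ?thesis by blast
qed

end

section \<open>Decrease of \<open>F\<close> per round and the limit argument\<close>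

context rpn_cg_setting
begin

lemma round_in_range:
  assumes "rpn_round k y s k' y' s'" "y \<in> M" "tmin \<le> s" "s \<le> tmax"
  shows "y' \<in> M" "tmin \<le> s'" "s' \<le> tmax"
proof -
  have "y' \<in> M \<and> tmin \<le> s' \<and> s' \<le> tmax"
    using assms(1)
  proof cases
    case (safeguarded d st \<alpha>)
    then show ?thesis
      using retraction_search_dir_in_M next_t_bounds assms(2-4) tmin_pos by auto
  next
    case (accepted d st y1 s1 d' st')
    have "y1 \<in> M" "tmin \<le> s1" "s1 \<le> tmax"
      \<comment> \<open>A full step is the step size 1.\<close>
      using retraction_search_dir_in_M[of s y d st 1] next_t_bounds accepted(4-6) assms(2-4) tmin_pos by auto
    then show ?thesis
      using retraction_search_dir_in_M[of s1 y1 d' st' 1] next_t_bounds accepted(2,3,7) tmin_pos by auto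
  qed
  then show "y' \<in> M" "tmin \<le> s'" "s' \<le> tmax" by auto
qed

lemma round_decrease:
  assumes small_tmin: "\<forall>y\<in>M. \<forall>d st. search_dir tmin y d st
      \<longrightarrow> (4 + 1 / tmin) * norm d \<ge> norm (pg_dir tmin y)"
    and \<epsilon>: "\<epsilon> > 0"
  shows "\<exists>\<eta>>0. \<forall>k y s k' y' s'. rpn_round k y s k' y' s' \<longrightarrow> y \<in> M \<longrightarrow> tmin \<le> s \<longrightarrow> s \<le> tmax \<longrightarrow>
    \<epsilon> \<le> norm (pg_dir s y) \<longrightarrow>
    F y' \<le> F y - \<eta> \<or> (F y' \<le> F y \<and> s \<noteq> tmin \<and> s' = max (\<omega>2 * s) tmin)"
proof -
  obtain a where a: "a > 0" "\<And>y s d st \<alpha>. y \<in> M \<Longrightarrow> 0 < s \<Longrightarrow> s \<le> tmax \<Longrightarrow> search_dir s y d st \<Longrightarrow>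
      backtracking_step y d \<alpha> \<Longrightarrow> F (R y (\<alpha> *\<^sub>R d)) \<le> F y - a * (norm d)\<^sup>2"
    using backtracking_step_decrease by blast
  define c where "c = 4 + 1 / tmin"
  have c: "c > 0" using tmin_pos by (simp add: c_def add_pos_pos)
  \<comment> \<open>The first value is the decrease enforced by the acceptance test. The second is
    the backtracking decrease with \<open>norm d \<ge> \<epsilon> / c\<close>, available when the
    direction is not too short compared with \<open>pg_dir s y\<close>.\<close>
  define \<eta> where "\<eta> = min (\<rho>1 * \<epsilon>\<^sup>2) (a * (\<epsilon> / c)\<^sup>2)"
  have "\<eta> > 0" using \<epsilon> \<rho>1_pos a(1) c by (simp add: \<eta>_def)
  moreover have "F y' \<le> F y - \<eta> \<or> (F y' \<le> F y \<and> s \<noteq> tmin \<and> s' = max (\<omega>2 * s) tmin)"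
    if "rpn_round k y s k' y' s'" and y: "y \<in> M" and s: "tmin \<le> s" "s \<le> tmax"
      and v: "\<epsilon> \<le> norm (pg_dir s y)" for k y s k' y' s'
    using that(1)
  proof cases
    case (safeguarded d st \<alpha>)
    have dec: "F y' \<le> F y - a * (norm d)\<^sup>2"
      using a(2)[OF y _ s(2) safeguarded(4,5)] s(1) tmin_pos safeguarded(2) by simp
    show ?thesis
    proof (cases "(4 + 1 / s) * norm d < norm (pg_dir s y)")
      \<comment> \<open>A too short direction gives no fixed decrease, but it triggers the shrinking
        of \<open>t\<close>; the assumption on \<open>tmin\<close> excludes it at
        \<open>tmin\<close>.\<close>
      case True
      then have "s \<noteq> tmin" using small_tmin y safeguarded(4) by fastforce
      moreover have "s' = max (\<omega>2 * s) tmin"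
        using True by (simp add: safeguarded(3) next_t_def)
      moreover have "F y' \<le> F y" using dec a(1) by (smt (verit) mult_nonneg_nonneg zero_le_power2)
      ultimately show ?thesis by blast
    next
      case False
      have "1 / s \<le> 1 / tmin" using s(1) tmin_pos by (intro divide_left_mono) auto
      then have "(4 + 1 / s) * norm d \<le> c * norm d"
        unfolding c_def by (intro mult_right_mono) auto
      then have "\<epsilon> \<le> c * norm d" using False v by linarith
      then have "\<epsilon> / c \<le> norm d" using c by (simp add: field_simps)
      then have "a * (\<epsilon> / c)\<^sup>2 \<le> a * (norm d)\<^sup>2"
        using a(1) \<epsilon> c by (intro mult_left_mono power_mono) auto
      then show ?thesis using dec by (simp add: \<eta>_def min_def)
    qed
  next
    \<comment> \<open>The acceptance test compares with the start of the round, so the value of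
      \<open>F\<close> at the tentative point is irrelevant.\<close>
    case (accepted d st y1 s1 d' st')
    have "\<rho>1 * \<epsilon>\<^sup>2 \<le> \<rho>1 * (norm (pg_dir s y))\<^sup>2"
      using v \<epsilon> \<rho>1_pos by (intro mult_left_mono power_mono) auto
    then show ?thesis using accepted by (simp add: \<eta>_def min_def)
  qed
  ultimately show ?thesis by blast
qed

lemma F_bounded_below: "\<exists>m. \<forall>y\<in>M. m \<le> F y"
proof -
  have "continuous_on M f"
    using f_differentiable differentiable_imp_continuous_within continuous_at_imp_continuous_on by blast
  then have "bounded (f ` M)"
    using compact compact_continuous_image compact_imp_bounded by blast
  then obtain b where b: "\<And>y. y \<in> M \<Longrightarrow> \<bar>f y\<bar> \<le> b" by (auto simp: bounded_iff)
  have "0 \<le> h y" for y using \<mu>_pos by (simp add: h_def l1_norm_def sum_nonneg)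
  then have "\<forall>y\<in>M. - b \<le> F y" using b unfolding F_def by (smt (verit))
  then show ?thesis by blast
qed

text \<open>The contradiction is drawn at round boundaries only, since \<open>F\<close> may increase
  at tentative points. A positive liminf bounds \<open>pg_dir\<close> from below at all late
  indices, in particular at these.\<close>

theorem liminf_pg_dir_eq_0:
  assumes small_tmin: "\<forall>y\<in>M. \<forall>d st. search_dir tmin y d st
      \<longrightarrow> (4 + 1 / tmin) * norm d \<ge> norm (pg_dir tmin y)"
    and gen: "generates x0 t0 x t" and x0: "x0 \<in> M" and t0: "tmin \<le> t0" "t0 \<le> tmax"
  shows "liminf (\<lambda>k. ereal (norm (pg_dir (t k) (x k)))) = 0"
proof (rule ccontr)
  let ?l = "liminf (\<lambda>k. ereal (norm (pg_dir (t k) (x k))))"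
  assume "?l \<noteq> 0"
  moreover have "0 \<le> ?l" by (rule Liminf_bounded) simp
  ultimately have "0 < ?l" by simp
  then obtain e where e: "0 < e" "e < ?l" using dense by blast
  then obtain \<epsilon> where \<epsilon>: "e = ereal \<epsilon>" "\<epsilon> > 0" by (cases e) auto
  obtain N where N: "\<And>k. k \<ge> N \<Longrightarrow> \<epsilon> \<le> norm (pg_dir (t k) (x k))"
    using less_LiminfD[OF e(2)] unfolding eventually_sequentially \<epsilon>(1) by (auto intro: less_imp_le)
  obtain k where k: "k 0 = 0" "x 0 = x0" "t 0 = t0"
      "\<And>i. rpn_round (k i) (x (k i)) (t (k i)) (k (Suc i)) (x (k (Suc i))) (t (k (Suc i)))"
    using generates_rounds[OF gen] by blast
  define y where "y i = x (k i)" for i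
  define s where "s i = t (k i)" for i
  have round_i: "rpn_round (k i) (y i) (s i) (k (Suc i)) (y (Suc i)) (s (Suc i))" for i
    using k(4) by (simp add: y_def s_def)
  \<comment> \<open>Hence round \<open>i\<close> starts at an index at least \<open>N\<close> as
    soon as \<open>i \<ge> N\<close>.\<close>
  have k_ge: "i \<le> k i" for i
    using round_gt[OF k(4)] by (intro seq_suble) (auto simp: strict_mono_Suc_iff)
  have range: "y i \<in> M \<and> tmin \<le> s i \<and> s i \<le> tmax" for i
  proof (induction i)
    case 0
    then show ?case using k x0 t0 by (simp add: y_def s_def)
  next
    case (Suc i)
    then show ?case using round_in_range[OF round_i[of i]] by blast
  qed
  obtain \<eta> where \<eta>: "\<eta> > 0" "\<And>k y s k' y' s'. rpn_round k y s k' y' s' \<Longrightarrow> y \<in> M \<Longrightarrow> tmin \<le> s \<Longrightarrow> s \<le> tmax \<Longrightarrow>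
    \<epsilon> \<le> norm (pg_dir s y) \<Longrightarrow>
    F y' \<le> F y - \<eta> \<or> (F y' \<le> F y \<and> s \<noteq> tmin \<and> s' = max (\<omega>2 * s) tmin)"
    using round_decrease[OF small_tmin \<epsilon>(2)] by blast
  have step: "F (y (Suc i)) \<le> F (y i) - \<eta> \<or>
      (F (y (Suc i)) \<le> F (y i) \<and> s i \<noteq> tmin \<and> s (Suc i) = max (\<omega>2 * s i) tmin)" if "i \<ge> N" for i
    using \<eta>(2)[OF round_i[of i]] range[of i] N[of "k i"] k_ge[of i] that by (simp add: y_def s_def)
  have drops: "\<exists>i\<ge>n. F (y (Suc i)) \<le> F (y i) - \<eta>" if "n \<ge> N" for n
  proof (rule ccontr)
    assume "\<not> ?thesis"
    then have no: "s i \<noteq> tmin \<and> s (Suc i) = max (\<omega>2 * s i) tmin" if "i \<ge> n" for i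
      using step[of i] that \<open>n \<ge> N\<close> by auto
    \<comment> \<open>If the maximum were attained by \<open>tmin\<close>, the next round would
      start at \<open>tmin\<close>, against \<open>no\<close>. So \<open>s\<close> decays
      geometrically and would fall below \<open>tmin\<close>.\<close>
    have s_Suc: "s (Suc i) = \<omega>2 * s i" if "i \<ge> n" for i
      using no[OF that] no[of "Suc i"] that by (auto simp: max_def split: if_splits)
    have "s (n + j) = \<omega>2 ^ j * s n" for j
      by (induction j) (simp_all add: s_Suc)
    moreover have "(\<lambda>j. \<omega>2 ^ j * s n) \<longlonglongrightarrow> 0 * s n"
      using \<omega>2 by (intro tendsto_intros LIMSEQ_realpow_zero) auto
    ultimately have "(\<lambda>j. s (n + j)) \<longlonglongrightarrow> 0" by simp
    then have "tmin \<le> 0" by (rule LIMSEQ_le_const) (use range in blast)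
    then show False using tmin_pos by simp
  qed
  obtain m where m: "\<And>y. y \<in> M \<Longrightarrow> m \<le> F y" using F_bounded_below by blast
  \<comment> \<open>A decreasing sequence bounded below converges, so its successive drops
    eventually stay under \<open>\<eta>\<close>, contradicting \<open>drops\<close>.\<close>
  define \<phi> where "\<phi> i = F (y (N + i))" for i
  have "decseq \<phi>"
    unfolding decseq_Suc_iff \<phi>_def using step[of "N + _"] \<eta>(1) by (smt (verit) add_Suc_right le_add1)
  moreover have "\<forall>i. m \<le> \<phi> i" unfolding \<phi>_def using m range by blast
  ultimately obtain l where l: "\<phi> \<longlonglongrightarrow> l" using decseq_convergent by blast
  have "(\<lambda>i. \<phi> i - \<phi> (Suc i)) \<longlonglongrightarrow> l - l"
    by (intro tendsto_intros l LIMSEQ_Suc)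
  then have "\<forall>\<^sub>F i in sequentially. \<phi> i - \<phi> (Suc i) < \<eta>"
    using \<eta>(1) by (intro order_tendstoD) auto
  then obtain n where n: "\<And>i. i \<ge> n \<Longrightarrow> \<phi> i - \<phi> (Suc i) < \<eta>"
    unfolding eventually_sequentially by blast
  obtain i where i: "i \<ge> N + n" "F (y (Suc i)) \<le> F (y i) - \<eta>" using drops[of "N + n"] by auto
  then have "\<phi> (i - N) - \<phi> (Suc (i - N)) \<ge> \<eta>" by (simp add: \<phi>_def)
  moreover have "n \<le> i - N" using i(1) by linarith
  ultimately show False using n[of "i - N"] by linarith
qed

end

theorem theorem3p1:
  fixes M :: "(real^'n) set"
    and dimM :: nat
    and R :: "real^'n \<Rightarrow> real^'n \<Rightarrow> real^'n"
    and f :: "real^'n \<Rightarrow> real"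
    and \<mu> :: real
    and B :: "real^'n \<Rightarrow> real^'c^'n"
    and lam :: "real \<Rightarrow> real^'n \<Rightarrow> real^'c"
    and vartheta \<gamma> \<tau> \<theta> \<kappa> :: real
    and \<alpha>init \<rho>1 \<rho>2 tmin tmax \<omega>1 \<omega>2 :: real
    and x0 :: "real^'n" and t0 :: real
    and x :: "nat \<Rightarrow> real^'n" and t :: "nat \<Rightarrow> real"
  assumes "compact M" and "embedded_submanifold M dimM" and "CARD('c) = CARD('n) - dimM"
    and "riem_retraction M R"
    and "C_on 2 UNIV f" and "\<exists>L. L-lipschitz_on UNIV (gradient f)"
    and "\<mu> > 0"
    and "\<forall>y\<in>M. orthonormal_normal_basis M y (B y)"
    and "\<forall>s>0. \<forall>y\<in>M. rpn_cg.lagrange_multiplier M f \<mu> B s y (lam s y)"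
    and "vartheta > 0" and "\<gamma> > 0" and "\<tau> > 0" and "\<theta> > 0" and "0 < \<kappa>" and "\<kappa> < 1"
    and "\<alpha>init > 0" and "0 < \<rho>1" and "\<rho>1 < 1" and "0 < \<rho>2" and "\<rho>2 < 1"
    and "0 < tmin" and "tmin \<le> tmax" and "tmin \<le> t0" and "t0 \<le> tmax"
    and "\<omega>1 > 1" and "0 < \<omega>2" and "\<omega>2 < 1"
    and line_search_well_defined: "\<rho>1 < \<gamma> / 2" "\<rho>1 < 1 / tmax"
    and "x0 \<in> M"
    and "\<forall>y\<in>M. \<forall>d st. rpn_cg.search_dir M f \<mu> B lam vartheta \<gamma> \<tau> \<theta> \<kappa> tmin y d st
            \<longrightarrow> (4 + 1 / tmin) * norm d \<ge> norm (rpn_cg.pg_dir M f \<mu> tmin y)"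
    and "rpn_cg.generates M R f \<mu> B lam vartheta \<gamma> \<tau> \<theta> \<kappa> \<alpha>init \<rho>1 \<rho>2 tmin tmax \<omega>1 \<omega>2 x0 t0 x t"
  shows "liminf (\<lambda>k. ereal (norm (rpn_cg.pg_dir M f \<mu> (t k) (x k)))) = 0"
proof -
  interpret rpn_cg_setting M R f \<mu> B lam vartheta \<gamma> \<tau> \<theta> \<kappa> \<alpha>init \<rho>1 \<rho>2 tmin tmax \<omega>1 \<omega>2
  proof
    show "f differentiable (at z)" for z
      using assms(5) by (simp add: numeral_2_eq_2)
    show "subspace (tangent_space M y)" if "y \<in> M" for y
      using subspace_tangent_space[OF assms(2) that] .
  qed (use assms in auto)
  show ?thesis
    by (rule liminf_pg_dir_eq_0) (fact assms)+
qed

end
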